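(* Let $\ell\geq 3$ be an integer and $s\in\mathbb{N}_0$. Then, as $t\to 0^+$, \[ F_{\ell,s}\left(e^{-t}\right) \sim \mathcal C_\ell \left(\frac{t}{2 \pi}\right)^{1-\frac{\ell^2}{2}}e^{-\frac{\pi^2\left(\ell^2-2\ell\right)}{6t}}, \qquad\text{where}\qquad \mathcal C_\ell := \frac{2^{1-2\ell}(\ell-1)!}{\Gamma\left(\frac{\ell+1}{2}\right)^2}. \]
   Context: Let $\tau=u+iv$ with $v>0$, $q:=e^{2\pi i\tau}$, $z=x+iy$, $\zeta:=e^{2\pi i z}$, and $(a)_\infty=(a;q)_\infty:=\prod_{j\geq 0}(1-aq^j)$. Define \[ F_{\ell,s}(q) := (q)_\infty^{\ell^2-1} \operatorname{coeff}_{\zeta^s} \frac{(q)_\infty}{(\zeta)_\infty^\ell\left(\zeta^{-1}q\right)_\infty^\ell}, \] where $\operatorname{coeff}_{\zeta^s}$ denotes the coefficient of $\zeta^s$ in the Laurent expansion in $\zeta$ valid in the range $0<y<v$ (i.e. $|q|<|\zeta|<1$). This is a function of $q$, evaluated here at $q=e^{-t}$, $t>0$. *)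

theory Defs
  imports "HOL-Complex_Analysis.Complex_Analysis" "HOL-Library.Landau_Symbols"
begin

definition qpoch_inf :: "complex \<Rightarrow> complex \<Rightarrow> complex" where
  "qpoch_inf a q = (\<Prod>j. 1 - a * q ^ j)"

definition is_laurent_expansion ::
    "real \<Rightarrow> real \<Rightarrow> (complex \<Rightarrow> complex) \<Rightarrow> (int \<Rightarrow> complex) \<Rightarrow> bool" where
  "is_laurent_expansion r R f c \<longleftrightarrow>
     (\<forall>\<zeta>. r < norm \<zeta> \<and> norm \<zeta> < R \<longrightarrow> ((\<lambda>n. c n * \<zeta> powi n) has_sum f \<zeta>) UNIV)"

text \<open>
  The description is meaningful whenever \<open>0 \<le> r < R\<close> and \<open>f\<close> is holomorphic on the annulus
  \<open>r < |\<zeta>| < R\<close>: the two-sided expansion then exists, converges absolutely, and its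
  coefficients are unique.
\<close>
definition laurent_coeff ::
    "real \<Rightarrow> real \<Rightarrow> (complex \<Rightarrow> complex) \<Rightarrow> int \<Rightarrow> complex" where
  "laurent_coeff r R f = (THE c. is_laurent_expansion r R f c)"

definition F :: "nat \<Rightarrow> int \<Rightarrow> complex \<Rightarrow> complex" where
  "F l s q = qpoch_inf q q powi ((int l)\<^sup>2 - 1) *
     laurent_coeff (norm q) 1
       (\<lambda>\<zeta>. qpoch_inf q q / (qpoch_inf \<zeta> q ^ l * qpoch_inf (inverse \<zeta> * q) q ^ l)) s"

definition C_const :: "nat \<Rightarrow> real" where
  "C_const l = 2 powi (1 - 2 * int l) * fact (l - 1) / (Gamma ((real l + 1) / 2))\<^sup>2"

end

theory Submission
  imports Defs "HOL-Real_Asymp.Real_Asymp"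
begin

text \<open>
  Write \<open>q = exp (- t)\<close>. The coefficient is an integral over the circle \<open>|\<zeta>| = q\<^sup>1\<^sup>/\<^sup>2\<close>, on which
  \<open>(\<zeta>)\<^sub>\<infinity> (q/\<zeta>)\<^sub>\<infinity>\<close> is real. After the substitution \<open>\<theta> = t u\<close> its quotient by its value at \<open>\<theta> = 0\<close> is
  \<open>\<Prod>j. 1 + sin\<^sup>2(t u / 2) / sinh\<^sup>2(t (j + 1/2) / 2)\<close>, which tends to
  \<open>\<Prod>j. 1 + u\<^sup>2 / (j + 1/2)\<^sup>2 = cosh (\<pi> u)\<close> and is at least \<open>1 + u\<^sup>2/4\<close>; so dominated convergence
  yields the constant \<open>\<integral> cosh (\<pi> u)\<^sup>-\<^sup>l du\<close>, computed by a recursion \<open>l \<rightarrow> l + 2\<close>.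

  No modular transformation is needed for the remaining factors. With \<open>E t = (q;q)\<^sub>\<infinity>\<close>, the value at
  \<open>\<theta> = 0\<close> is \<open>(E (t/2) / E t)\<^sup>2\<close>, and a \<open>q\<close>-analogue of Wallis' product gives the limit of
  \<open>t (E t)\<^sup>4 / (E (t/2))\<^sup>2\<close>. Hence the error \<open>R\<close> in \<open>ln (E t) = - \<pi>\<^sup>2/(6t) + ln (2\<pi>/t) / 2 + R t\<close> satisfies
  \<open>R t - R (t/2) / 2 \<longrightarrow> 0\<close>; the only other input needed to conclude \<open>R t \<longrightarrow> 0\<close> is the leading
  term \<open>t ln (E t) \<longrightarrow> - \<pi>\<^sup>2/6\<close>.
\<close>

section \<open>Infinite products\<close>

text \<open>At distance from the singularity at -1 the logarithm is Lipschitz; the negative side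
  follows from \<open>ln y \<le> y - 1\<close> at \<open>y = 1 / (1 + x)\<close>. A summable
  majorant for the deviations of factors from 1 thus serves, doubled, for their logarithms.\<close>

lemma abs_ln_one_plus_le:
  fixes x :: real
  assumes "x \<ge> -1/2"
  shows "\<bar>ln (1 + x)\<bar> \<le> 2 * \<bar>x\<bar>"
proof -
  have "ln (1 + x) \<le> x" using assms by (intro ln_add_one_self_le_self2) auto
  moreover have "- ln (1 + x) \<le> 2 * \<bar>x\<bar>"
  proof -
    have "- ln (1 + x) = ln (1 / (1 + x))" using assms by (simp add: ln_div)
    also have "\<dots> \<le> 1 / (1 + x) - 1" using assms by (intro ln_le_minus_one) auto
    also have "\<dots> = - x / (1 + x)" using assms by (simp add: field_simps)
    also have "\<dots> \<le> 2 * \<bar>x\<bar>"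
    proof (cases "x \<ge> 0")
      case True
      thus ?thesis by (simp add: divide_nonpos_nonneg order_trans[of _ 0])
    next
      case False
      have "-x \<le> 2 * (-x) * (1 + x)"
        using mult_nonneg_nonneg[of "-x" "1 + 2 * x"] False assms by (simp add: algebra_simps)
      hence "-x / (1 + x) \<le> 2 * (-x)" using assms by (subst pos_divide_le_eq) auto
      thus ?thesis using False by simp
    qed
    finally show ?thesis .
  qed
  ultimately show ?thesis by linarith
qed

lemma convergent_prod_one_plus:
  fixes a :: "nat \<Rightarrow> real"
  assumes "\<And>k. a k \<ge> -1/2" "\<And>k. \<bar>a k\<bar> \<le> M k" "summable M"
  shows "convergent_prod (\<lambda>k. 1 + a k)"
proof (rule summable_imp_convergent_prod_real)
  show "summable (\<lambda>k. \<bar>a k\<bar>)"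
    by (rule summable_comparison_test'[OF assms(3)]) (use assms(2) in auto)
  show "a k \<noteq> -1" for k using assms(1)[of k] by auto
qed

text \<open>Dominated convergence for products: taking logarithms reduces it to Tannery's theorem
  for series. The lower bound -1/2 keeps every factor at least 1/2, so that the logarithms are
  controlled by \<open>2 * M k\<close>.\<close>

lemma tendsto_prodinf_dominated:
  fixes a :: "nat \<Rightarrow> 'a \<Rightarrow> real"
  assumes lim: "\<And>k. (a k \<longlongrightarrow> b k) L"
    and ev: "eventually (\<lambda>t. \<forall>k. a k t \<ge> -1/2 \<and> \<bar>a k t\<bar> \<le> M k) L"
    and M: "summable M" and L: "L \<noteq> bot"
  shows "((\<lambda>t. \<Prod>k. 1 + a k t) \<longlongrightarrow> (\<Prod>k. 1 + b k)) L"
proof -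
  \<comment> \<open>Both bounds pass to the limits, so the limiting product is also the exponential
    of its logarithmic series.\<close>
  have b: "b k \<ge> -1/2" "\<bar>b k\<bar> \<le> M k" for k
  proof -
    show "b k \<ge> -1/2"
      by (rule tendsto_lowerbound[OF lim[of k] _ L]) (rule eventually_mono[OF ev], auto)
    show "\<bar>b k\<bar> \<le> M k"
      by (rule tendsto_upperbound[OF tendsto_rabs[OF lim[of k]] _ L])
         (rule eventually_mono[OF ev], auto)
  qed
  have eq: "(\<Prod>k. 1 + c k) = exp (\<Sum>k. ln (1 + c k))"
    if "\<And>k. c k \<ge> -1/2" "\<And>k. \<bar>c k\<bar> \<le> M k" for c :: "nat \<Rightarrow> real"
  proof -
    have conv: "convergent_prod (\<lambda>k. 1 + c k)"
      by (rule convergent_prod_one_plus[OF that M])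
    have pos: "1 + c k > 0" for k using that(1)[of k] by simp
    show ?thesis
      by (subst suminf_ln_real[OF conv pos]) (use less_0_prodinf[OF conv pos] in simp)
  qed
  have "((\<lambda>t. \<Sum>k. ln (1 + a k t)) \<longlongrightarrow> (\<Sum>k. ln (1 + b k))) L"
  proof (rule tannerys_theorem[THEN conjunct2, THEN conjunct2])
    show "((\<lambda>t. ln (1 + a k t)) \<longlongrightarrow> ln (1 + b k)) L" for k
      using b(1)[of k] by (intro tendsto_intros lim) auto
    show "summable (\<lambda>k. 2 * M k)" using M by (rule summable_mult)
    show "eventually (\<lambda>(k, t). norm (ln (1 + a k t)) \<le> 2 * M k) (at_top \<times>\<^sub>F L)"
      unfolding eventually_prod_filter
    proof (intro exI conjI allI impI)
      show "eventually (\<lambda>k::nat. True) at_top" by simp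
      show "eventually (\<lambda>t. \<forall>k. a k t \<ge> -1/2 \<and> \<bar>a k t\<bar> \<le> M k) L" by (rule ev)
      fix k t assume "\<forall>k. a k t \<ge> -1/2 \<and> \<bar>a k t\<bar> \<le> M k"
      hence *: "a k t \<ge> -1/2" "\<bar>a k t\<bar> \<le> M k" by auto
      show "case (k, t) of (k, t) \<Rightarrow> norm (ln (1 + a k t)) \<le> 2 * M k"
        using abs_ln_one_plus_le[OF *(1)] *(2) by simp
    qed
  qed (rule L)
  hence "((\<lambda>t. exp (\<Sum>k. ln (1 + a k t))) \<longlongrightarrow> exp (\<Sum>k. ln (1 + b k))) L"
    by (rule tendsto_exp)
  also have "exp (\<Sum>k. ln (1 + b k)) = (\<Prod>k. 1 + b k)" using eq[of b] b by simp
  finally show ?thesis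
    by (rule Lim_transform_eventually) (rule eventually_mono[OF ev], auto simp: eq)
qed

section \<open>The products over integer and half-integer powers of q\<close>

text \<open>For \<open>q = exp (- t)\<close> this is the q-Pochhammer symbol (q^c; q)_infinity:
  \<open>c = 1\<close> gives the Euler product, \<open>c = 1/2\<close> the half-integer
  product.\<close>

definition qprod :: "real \<Rightarrow> real \<Rightarrow> real" where
  "qprod c t = (\<Prod>j. 1 - exp (- (t * (real j + c))))"

lemma summable_exp_shift:
  assumes "t > 0" shows "summable (\<lambda>j. exp (- (t * (real j + c))))"
proof -
  have "(\<lambda>j. exp (- (t * (real j + c)))) = (\<lambda>j. exp (- (t * c)) * exp (- t) ^ j)"
    by (auto simp: fun_eq_iff exp_of_nat_mult[symmetric] exp_add[symmetric] algebra_simps)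
  thus ?thesis using assms by (simp add: summable_geometric)
qed

lemma has_prod_qprod:
  assumes "t > 0" "c > 0"
  shows "(\<lambda>j. 1 - exp (- (t * (real j + c)))) has_prod qprod c t"
proof -
  have "convergent_prod (\<lambda>j. 1 + (- exp (- (t * (real j + c)))))"
  proof (rule summable_imp_convergent_prod_real)
    show "- exp (- (t * (real k + c))) \<noteq> -1" for k using assms
      by (metis add_nonneg_pos exp_eq_one_iff less_irrefl mult_pos_pos neg_equal_iff_equal
          neg_equal_0_iff_equal of_nat_0_le_iff)
  qed (use summable_exp_shift[OF assms(1)] in simp)
  thus ?thesis unfolding qprod_def by (simp add: convergent_prod_has_prod)
qed

lemma one_minus_exp_pos:
  assumes "t > 0" "c > 0" shows "0 < 1 - exp (- (t * (real j + c)))"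
  using assms by (simp add: add_nonneg_pos)

lemma qprod_pos:
  assumes "t > 0" "c > 0" shows "qprod c t > 0"
  using has_prod_pos[OF has_prod_qprod[OF assms]] one_minus_exp_pos[OF assms] by blast

text \<open>Halving \<open>t\<close> replaces q by its square root, whose powers are the
  half-integer powers of q at even indices \<open>j\<close> and the integer powers at odd
  ones.\<close>

lemma qprod_1_half:
  assumes "t > 0"
  shows "qprod 1 (t / 2) = qprod 1 t * qprod (1/2) t"
proof (rule LIMSEQ_unique)
  have split: "(\<Prod>j<2*n. 1 - exp (- (t / 2 * (real j + 1)))) =
      (\<Prod>j<n. 1 - exp (- (t * (real j + 1)))) * (\<Prod>j<n. 1 - exp (- (t * (real j + 1/2))))" for n
  proof (induction n)
    case (Suc n)
    have "t / 2 * (real (2 * n) + 1) = t * (real n + 1/2)"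
      "t / 2 * (real (Suc (2 * n)) + 1) = t * (real n + 1)" by (simp_all add: algebra_simps)
    hence "(\<Prod>j<2*Suc n. 1 - exp (- (t / 2 * (real j + 1)))) =
      (\<Prod>j<2*n. 1 - exp (- (t / 2 * (real j + 1)))) *
        ((1 - exp (- (t * (real n + 1/2)))) * (1 - exp (- (t * (real n + 1)))))"
      by (simp only: mult_Suc_right add_2_eq_Suc prod.lessThan_Suc mult.assoc)
    thus ?case unfolding Suc by (simp add: mult_ac)
  qed simp
  have "(\<lambda>n. \<Prod>j<n. 1 - exp (- (t / 2 * (real j + 1)))) \<longlonglongrightarrow> qprod 1 (t / 2)"
    using assms by (intro has_prod_imp_tendsto' has_prod_qprod) auto
  from LIMSEQ_subseq_LIMSEQ[OF this, of "\<lambda>n. 2 * n"]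
  show "(\<lambda>n. \<Prod>j<2*n. 1 - exp (- (t / 2 * (real j + 1)))) \<longlonglongrightarrow> qprod 1 (t / 2)"
    by (simp add: strict_mono_def o_def)
  show "(\<lambda>n. \<Prod>j<2*n. 1 - exp (- (t / 2 * (real j + 1)))) \<longlonglongrightarrow> qprod 1 t * qprod (1/2) t"
    unfolding split using assms by (intro tendsto_mult has_prod_imp_tendsto' has_prod_qprod) auto
qed

section \<open>Estimates for the hyperbolic sine and the q-Wallis product\<close>

lemma sinh_ge_self: "sinh x \<ge> x" if "x \<ge> 0" for x :: real
proof -
  have "sinh 0 - 0 \<le> sinh x - x"
    by (rule DERIV_nonneg_imp_nondecreasing[OF that])
       (auto intro!: exI derivative_eq_intros simp: cosh_real_ge_1)
  thus ?thesis by simp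
qed

text \<open>Induction with the addition formula, in which both hyperbolic cosines are at least
  1.\<close>

lemma sinh_mult_ge: "sinh (real n * x) \<ge> real n * sinh x" if "x \<ge> 0" for x :: real
proof (induction n)
  case (Suc n)
  have "sinh (real (Suc n) * x) = sinh (real n * x) * cosh x + cosh (real n * x) * sinh x"
    using sinh_add[of "real n * x" x] by (simp add: algebra_simps)
  moreover have "sinh (real n * x) * 1 \<le> sinh (real n * x) * cosh x"
    using that by (intro mult_left_mono) (auto simp: cosh_real_ge_1)
  moreover have "1 * sinh x \<le> cosh (real n * x) * sinh x"
    using that by (intro mult_right_mono) (auto simp: cosh_real_ge_1)
  ultimately show ?case using Suc by (simp add: algebra_simps)
qed auto

text \<open>Extracting \<open>exp (- x / 2)\<close> from \<open>1 - exp (- x)\<close> leaves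
  \<open>2 * sinh (x / 2)\<close>. This turns squared factors of the q-products into hyperbolic
  sines.\<close>

lemma one_minus_exp_sq: "(1 - exp (- x))\<^sup>2 = 4 * exp (- x) * (sinh (x / 2))\<^sup>2" for x :: real
proof -
  have "exp (- x) = exp (- (x / 2)) ^ 2" by (simp add: exp_double[symmetric])
  moreover have "exp (x / 2) = inverse (exp (- (x / 2)))" by (simp add: exp_minus)
  ultimately show ?thesis
    by (simp add: sinh_field_def power2_eq_square field_simps)
qed

text \<open>The argument in the denominator is the integer multiple \<open>2 * (j + 1)\<close> of
  \<open>t / 4\<close>, so \<open>sinh_mult_ge\<close> applies. The resulting bound is free of
  \<open>t\<close>, as dominated convergence requires.\<close>

lemma sinh_sq_ratio_le:
  fixes t :: real
  assumes "t > 0"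
  shows "(sinh (t / 4))\<^sup>2 / (sinh (t * (real j + 1) / 2))\<^sup>2 \<le> 1 / 4 * (1 / (real j + 1)\<^sup>2)"
proof -
  have s: "sinh (t / 4) > 0" using assms by simp
  have "2 * (real j + 1) * sinh (t / 4) \<le> sinh (t * (real j + 1) / 2)"
    using sinh_mult_ge[of "t/4" "2 * (j + 1)"] assms by (simp add: algebra_simps add_divide_distrib)
  moreover have "sinh (t * (real j + 1) / 2) > 0" using assms by simp
  ultimately have "sinh (t / 4) / sinh (t * (real j + 1) / 2) \<le> 1 / (2 * (real j + 1))"
    using s by (simp add: field_simps)
  hence "(sinh (t / 4) / sinh (t * (real j + 1) / 2))\<^sup>2 \<le> (1 / (2 * (real j + 1)))\<^sup>2"
    using assms by (intro power_mono) auto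
  thus ?thesis by (simp only: power_divide power_mult_distrib) simp
qed

text \<open>The first factor of the half-integer product is split off so that the remaining factors
  pair up symmetrically around the integers, as in Wallis' product.\<close>

lemma qprod_wallis:
  assumes "t > 0"
  shows "(qprod 1 t / qprod (1/2) t)\<^sup>2 * (1 - exp (- (t / 2))) *
           (\<Prod>j. 1 + - ((sinh (t / 4))\<^sup>2 / (sinh (t * (real j + 1) / 2))\<^sup>2)) = 1"
proof -
  define a where "a j = - ((sinh (t / 4))\<^sup>2 / (sinh (t * (real j + 1) / 2))\<^sup>2)" for j
  define e where "e x = 1 - exp (- (t * x))" for x
  \<comment> \<open>With \<open>A = exp (- (t * (real j + 1)))\<close> the right side is (1 - A
    exp(t/2)) (1 - A exp(-t/2)): the correction \<open>1 + a j\<close> turns the squared factor at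
    an integer into the product of the factors at its two half-integer neighbours.\<close>
  have fac: "(e (real j + 1))\<^sup>2 * (1 + a j) = e (real j + 1/2) * e (real j + 3/2)" for j
  proof -
    have "sinh (t * (real j + 1) / 2) \<noteq> 0" using assms by (simp add: add_nonneg_eq_0_iff)
    hence "(e (real j + 1))\<^sup>2 * (1 + a j) =
        (e (real j + 1))\<^sup>2 - 4 * exp (- (t * (real j + 1))) * (sinh (t / 4))\<^sup>2"
      unfolding e_def a_def one_minus_exp_sq by (simp add: field_simps)
    also have "(sinh (t / 4))\<^sup>2 = (exp (t / 2) + exp (- (t / 2)) - 2) / 4"
      using cosh_square_eq[of "t/4"] cosh_double[of "t/4"]
      by (simp add: cosh_field_def field_simps)
    also have "(e (real j + 1))\<^sup>2 - 4 * exp (- (t * (real j + 1))) * ((exp (t / 2) + exp (- (t / 2)) - 2) / 4)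
        = e (real j + 1/2) * e (real j + 3/2)"
    proof -
      define A where "A = exp (- (t * (real j + 1)))"
      have "exp (- (t * (real j + 1/2))) = A * exp (t / 2)"
        "exp (- (t * (real j + 3/2))) = A * exp (- (t / 2))"
        unfolding A_def exp_add[symmetric] by (simp_all add: algebra_simps)
      moreover have "exp (t / 2) * exp (- (t / 2)) = 1" by (simp flip: exp_add)
      ultimately show ?thesis unfolding e_def A_def[symmetric] by algebra
    qed
    finally show ?thesis .
  qed
  \<comment> \<open>Inner half-integers are reached from both sides. The end 1/2 is reached once,
    hence the additional \<open>e (1/2)\<close> on the left; the end n + 1/2 is left over on the
    right and tends to 1.\<close>
  have fin: "(\<Prod>j<n. e (real j + 1))\<^sup>2 * e (1/2) * (\<Prod>j<n. 1 + a j) =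
             (\<Prod>j<n. e (real j + 1/2))\<^sup>2 * e (real n + 1/2)" for n
  proof (induction n)
    case (Suc n)
    have "(\<Prod>j<Suc n. e (real j + 1))\<^sup>2 * e (1/2) * (\<Prod>j<Suc n. 1 + a j) =
      ((\<Prod>j<n. e (real j + 1))\<^sup>2 * e (1/2) * (\<Prod>j<n. 1 + a j)) * ((e (real n + 1))\<^sup>2 * (1 + a n))"
      by (simp add: power_mult_distrib)
    also have "\<dots> = (\<Prod>j<Suc n. e (real j + 1/2))\<^sup>2 * e (real (Suc n) + 1/2)"
      unfolding Suc fac by (simp add: power_mult_distrib power2_eq_square add.commute)
    finally show ?case .
  qed simp
  note bnd = sinh_sq_ratio_le[OF assms]
  have sm: "summable (\<lambda>j. 1 / 4 * (1 / (real j + 1)\<^sup>2))"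
    using inverse_squares_sums by (intro summable_mult) (auto simp: sums_iff add.commute)
  have cp: "convergent_prod (\<lambda>j. 1 + a j)"
  proof (rule convergent_prod_one_plus[OF _ _ sm])
    show "- 1 / 2 \<le> a k" for k
    proof -
      have "1 / (real k + 1)\<^sup>2 \<le> 1" by (simp add: one_le_power)
      thus ?thesis using bnd[of k] unfolding a_def by linarith
    qed
    show "\<bar>a k\<bar> \<le> 1 / 4 * (1 / (real k + 1)\<^sup>2)" for k
      using bnd[of k] unfolding a_def by simp
  qed
  have l1: "(\<lambda>n. (\<Prod>j<n. e (real j + 1))\<^sup>2 * e (1/2) * (\<Prod>j<n. 1 + a j))
     \<longlonglongrightarrow> (qprod 1 t)\<^sup>2 * e (1/2) * (\<Prod>j. 1 + a j)"
    unfolding e_def using assms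
    by (intro tendsto_intros has_prod_imp_tendsto' has_prod_qprod convergent_prod_has_prod cp) auto
  have "(\<lambda>n. e (real n + 1/2)) \<longlonglongrightarrow> 1" unfolding e_def using assms by real_asymp
  hence l2: "(\<lambda>n. (\<Prod>j<n. e (real j + 1/2))\<^sup>2 * e (real n + 1/2)) \<longlonglongrightarrow> (qprod (1/2) t)\<^sup>2 * 1"
    unfolding e_def using assms
    by (intro tendsto_mult tendsto_power has_prod_imp_tendsto' has_prod_qprod) auto
  have "(qprod 1 t)\<^sup>2 * e (1/2) * (\<Prod>j. 1 + a j) = (qprod (1/2) t)\<^sup>2"
    using LIMSEQ_unique[OF l1] l2 unfolding fin by simp
  thus ?thesis using qprod_pos[of t "1/2"] assms unfolding a_def e_def
    by (simp add: field_simps power_divide)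
qed

section \<open>Asymptotics of the Euler product\<close>

text \<open>Wallis' product, as Euler's sine product at 1/2.\<close>

lemma prodinf_wallis: "(\<Prod>j. 1 + - (1 / 4 * (1 / (real j + 1)\<^sup>2))) = 2 / pi"
proof -
  have "(\<lambda>n. \<Prod>k=1..n. 1 - (1/2)\<^sup>2 / (real k)\<^sup>2) \<longlonglongrightarrow> 2 / pi"
    using sin_product_formula_real'[of "1/2"] by simp
  also have "(\<lambda>n. \<Prod>k=1..n. 1 - (1/2)\<^sup>2 / (real k)\<^sup>2) =
      (\<lambda>n. \<Prod>j<n. 1 + - (1 / 4 * (1 / (real j + 1)\<^sup>2)))"
    by (simp add: prod.shift_bounds_Suc_ivl atLeast0LessThan[symmetric] fun_eq_iff
        prod.atLeast1_atMost_eq power2_eq_square add.commute)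
  finally show ?thesis by (rule prodinf_eq_prod_lim') (auto simp: power2_eq_square add_eq_0_iff)
qed

text \<open>In \<open>qprod_wallis\<close> the correction terms tend to those of Wallis' product, of
  value 2/pi, while \<open>t / (1 - exp (- (t / 2)))\<close> tends to 2; the quotient of these
  limits is pi.\<close>

lemma qprod_ratio_limit: "((\<lambda>t. t * (qprod 1 t / qprod (1/2) t)\<^sup>2) \<longlongrightarrow> pi) (at_right 0)"
proof -
  define a where "a j t = - ((sinh (t / 4))\<^sup>2 / (sinh (t * (real j + 1) / 2))\<^sup>2)" for j and t :: real
  have bnd: "\<bar>a j t\<bar> \<le> 1 / 4 * (1 / (real j + 1)\<^sup>2)" if "t > 0" for j t
    using sinh_sq_ratio_le[OF that, of j] unfolding a_def by simp
  have sm: "summable (\<lambda>j. 1 / 4 * (1 / (real j + 1)\<^sup>2))"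
    using inverse_squares_sums by (intro summable_mult) (auto simp: sums_iff add.commute)
  have "((\<lambda>t. \<Prod>j. 1 + a j t) \<longlongrightarrow> (\<Prod>j. 1 + - (1 / 4 * (1 / (real j + 1)\<^sup>2)))) (at_right 0)"
  proof (rule tendsto_prodinf_dominated[OF _ _ sm])
    fix j :: nat
    have "((\<lambda>t. - ((sinh (t / 4))\<^sup>2 / (sinh (t * c / 2))\<^sup>2)) \<longlongrightarrow> - (1/4 * (1 / c\<^sup>2))) (at_right 0)"
      if "c > 0" for c :: real
    proof -
      have "((\<lambda>t. - ((sinh (t / 4))\<^sup>2 / (sinh (t * c / 2))\<^sup>2)) \<longlongrightarrow> - (((1/4) / (c/2))^2)) (at_right 0)"
        using that by (real_asymp simp: power2_eq_square field_simps)
      thus ?thesis by (simp add: power2_eq_square field_simps)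
    qed
    thus "(a j \<longlongrightarrow> - (1 / 4 * (1 / (real j + 1)\<^sup>2))) (at_right 0)"
      unfolding a_def by simp
  next
    have "- 1 / 2 \<le> a j t" if "t > 0" for j t
    proof -
      have "1 / (real j + 1)\<^sup>2 \<le> 1" by (simp add: one_le_power)
      thus ?thesis using bnd[OF that, of j] by linarith
    qed
    thus "\<forall>\<^sub>F t in at_right 0. \<forall>k. - 1 / 2 \<le> a k t \<and> \<bar>a k t\<bar> \<le> 1 / 4 * (1 / (real k + 1)\<^sup>2)"
      using bnd eventually_at_right_less[of "0::real"] by (auto elim!: eventually_mono)
  qed auto
  hence "((\<lambda>t. t / (1 - exp (- (t / 2))) / (\<Prod>j. 1 + a j t)) \<longlongrightarrow> 2 / (2 / pi)) (at_right 0)"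
    unfolding prodinf_wallis by (intro tendsto_divide) (real_asymp, auto)
  moreover have "\<forall>\<^sub>F t in at_right 0. t / (1 - exp (- (t / 2))) / (\<Prod>j. 1 + a j t) =
      t * (qprod 1 t / qprod (1/2) t)\<^sup>2"
    using eventually_at_right_less[of "0::real"]
  proof eventually_elim
    case (elim t)
    define w where "w = (\<Prod>j. 1 + a j t)"
    have "y = 1 / d / w" if "y * d * w = 1" for y d :: real
    proof -
      have "d \<noteq> 0" "w \<noteq> 0" using that by auto
      thus ?thesis using that by (simp add: nonzero_eq_divide_eq)
    qed
    from this[OF qprod_wallis[OF elim, folded a_def w_def]] show ?case
      unfolding w_def[symmetric] by simp
  qed
  ultimately show ?thesis by (auto elim: Lim_transform_eventually)
qed

section \<open>Logarithm of the Euler product: leading term and error term\<close>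

text \<open>Expanding each logarithm gives the double series of q^((n+1)(j+1)) / (n+1). Its terms
  are nonnegative, so the order of summation may be exchanged, and summing over \<open>j\<close>
  first gives geometric series.\<close>

lemma ln_qprod_1:
  assumes "t > 0"
  shows "(\<lambda>n. 1 / (real n + 1) * (1 / (exp (t * (real n + 1)) - 1))) sums (- ln (qprod 1 t))"
proof -
  define f where "f = (\<lambda>(n, j). exp (- (t * (real n + 1) * (real j + 1))) / (real n + 1))"
  define g where "g n = 1 / (real n + 1) * (1 / (exp (t * (real n + 1)) - 1))" for n :: nat
  have g_nonneg: "g n \<ge> 0" for n unfolding g_def using assms by simp
  have row: "((\<lambda>j. f (n, j)) has_sum g n) UNIV" for n
  proof (rule sums_nonneg_imp_has_sum)
    define x where "x = exp (- (t * (real n + 1)))"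
    have x: "0 < x" "x < 1" unfolding x_def using assms by (auto simp: add_nonneg_pos)
    have "(\<lambda>j. x / (real n + 1) * x ^ j) sums (x / (real n + 1) * (1 / (1 - x)))"
      using x by (intro sums_mult geometric_sums) auto
    moreover have "x / (real n + 1) * (1 / (1 - x)) = g n"
    proof -
      have "exp (t * (real n + 1)) = 1 / x" unfolding x_def by (simp add: exp_minus inverse_eq_divide)
      moreover have "1 / (1 / x - 1) = x * (1 / (1 - x))" using x by (simp add: field_simps)
      ultimately show ?thesis unfolding g_def by simp
    qed
    moreover have "x / (real n + 1) * x ^ j = f (n, j)" for j
      unfolding f_def x_def by (simp add: exp_of_nat_mult[symmetric] exp_add[symmetric] algebra_simps)
    ultimately show "(\<lambda>j. f (n, j)) sums g n" by simp
  qed (auto simp: f_def)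
  have col: "((\<lambda>n. f (n, j)) has_sum (- ln (1 - exp (- (t * (real j + 1)))))) UNIV" for j
  proof (rule sums_nonneg_imp_has_sum)
    define x where "x = exp (- (t * (real j + 1)))"
    have x: "0 < x" "x < 1" unfolding x_def using assms by (auto simp: add_nonneg_pos)
    have "(\<lambda>n. - ((- (-x)) ^ n) / real n) sums ln (1 + (-x))"
      using x by (intro ln_series') auto
    hence "(\<lambda>n. x ^ n / real n) sums (- ln (1 - x))"
      using sums_minus[of "\<lambda>n. - (x ^ n) / real n"] by simp
    hence "(\<lambda>n. x ^ Suc n / real (Suc n)) sums (- ln (1 - x))"
      by (subst sums_Suc_iff) simp
    moreover have "x ^ Suc n / real (Suc n) = f (n, j)" for n
      unfolding f_def x_def exp_of_nat_mult[symmetric] by (simp add: algebra_simps)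
    ultimately show "(\<lambda>n. f (n, j)) sums (- ln (1 - exp (- (t * (real j + 1)))))"
      by (simp add: x_def)
  qed (auto simp: f_def)
  have "summable g"
  proof (rule summable_comparison_test'[of "\<lambda>n. 1 / t * (1 / (real n + 1)\<^sup>2)" 0])
    show "summable (\<lambda>n. 1 / t * (1 / (real n + 1)\<^sup>2))"
      using inverse_squares_sums by (intro summable_mult) (auto simp: sums_iff add.commute)
    fix n :: nat
    have "t * (real n + 1) \<le> exp (t * (real n + 1)) - 1"
      using exp_ge_add_one_self[of "t * (real n + 1)"] by linarith
    hence "1 / (real n + 1) * (1 / (exp (t * (real n + 1)) - 1)) \<le> 1 / (real n + 1) * (1 / (t * (real n + 1)))"
      using assms by (intro mult_left_mono divide_left_mono mult_pos_pos) (auto simp: add_nonneg_pos)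
    thus "norm (g n) \<le> 1 / t * (1 / (real n + 1)\<^sup>2)"
      using g_nonneg[of n] unfolding g_def by (simp add: power2_eq_square field_simps)
  qed
  hence gs: "g summable_on UNIV" by (intro summable_nonneg_imp_summable_on g_nonneg)
  have "f summable_on (UNIV \<times> UNIV)"
    by (rule summable_on_SigmaI[OF row gs]) (auto simp: f_def)
  hence tot: "(f has_sum infsum g UNIV) (UNIV \<times> UNIV)"
    using has_sum_SigmaI[OF row has_sum_infsum[OF gs]] by auto
  have "((\<lambda>j. - ln (1 - exp (- (t * (real j + 1))))) has_sum infsum g UNIV) UNIV"
    by (rule has_sum_SigmaD[OF tot[unfolded has_sum_swap[of f]]]) (use col in auto)
  hence "(\<Sum>j. - ln (1 - exp (- (t * (real j + 1))))) = infsum g UNIV"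
    by (rule sums_unique[OF has_sum_imp_sums, symmetric])
  moreover have "(\<Sum>j. ln (1 - exp (- (t * (real j + 1))))) = ln (qprod 1 t)"
    unfolding qprod_def using has_prod_qprod[OF assms, of 1] one_minus_exp_pos[OF assms, of 1]
    by (intro suminf_ln_real) (auto simp: has_prod_iff)
  moreover have "summable (\<lambda>j. ln (1 - exp (- (t * (real j + 1)))))"
    using has_prod_qprod[OF assms, of 1] one_minus_exp_pos[OF assms, of 1]
    by (intro summable_ln_real) (auto simp: has_prod_iff)
  ultimately have "infsum g UNIV = - ln (qprod 1 t)" by (simp add: suminf_minus)
  with has_sum_infsum[OF gs] show ?thesis unfolding g_def by (auto intro: has_sum_imp_sums)
qed

text \<open>Multiplied by \<open>t\<close>, each term of the series in \<open>ln_qprod_1\<close>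
  tends to \<open>1 / (real n + 1)\<^sup>2\<close> and is bounded by it, because exp y - 1 is at
  least y. Tannery's theorem then produces the Basel sum.\<close>

lemma ln_qprod_1_leading: "((\<lambda>t. t * ln (qprod 1 t)) \<longlongrightarrow> - (pi\<^sup>2 / 6)) (at_right 0)"
proof -
  define a where "a n t = 1 / (real n + 1) * (t / (exp (t * (real n + 1)) - 1))" for n and t :: real
  have "((\<lambda>t. \<Sum>n. a n t) \<longlongrightarrow> (\<Sum>n. 1 / (real n + 1)\<^sup>2)) (at_right 0)"
  proof (rule tannerys_theorem[THEN conjunct2, THEN conjunct2])
    fix n :: nat
    have "((\<lambda>t. t / (exp (t * c) - 1)) \<longlongrightarrow> 1 / c) (at_right 0)" if "c > 0" for c :: real
      using that by (real_asymp simp: field_simps)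
    hence "(a n \<longlongrightarrow> 1 / (real n + 1) * (1 / (real n + 1))) (at_right 0)"
      unfolding a_def by (intro tendsto_mult tendsto_const) auto
    thus "(a n \<longlongrightarrow> 1 / (real n + 1)\<^sup>2) (at_right 0)" by (simp add: power2_eq_square)
  next
    show "\<forall>\<^sub>F (n, t) in sequentially \<times>\<^sub>F at_right 0. norm (a n t) \<le> 1 / (real n + 1)\<^sup>2"
      unfolding eventually_prod_filter
    proof (intro exI conjI allI impI)
      show "\<forall>\<^sub>F n::nat in sequentially. True" by simp
      show "\<forall>\<^sub>F t::real in at_right 0. t > 0" by (rule eventually_at_right_less)
      fix n :: nat and t :: real assume t: "t > 0"
      have "t * (real n + 1) \<le> exp (t * (real n + 1)) - 1"
        using exp_ge_add_one_self[of "t * (real n + 1)"] by linarith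
      hence "t / (exp (t * (real n + 1)) - 1) \<le> t / (t * (real n + 1))"
        using t by (intro divide_left_mono mult_pos_pos) (auto simp: add_nonneg_pos)
      hence "a n t \<le> 1 / (real n + 1) * (t / (t * (real n + 1)))"
        unfolding a_def by (intro mult_left_mono) auto
      moreover have "a n t \<ge> 0" unfolding a_def using t by simp
      ultimately show "case (n, t) of (n, t) \<Rightarrow> norm (a n t) \<le> 1 / (real n + 1)\<^sup>2"
        using t by (simp add: power2_eq_square)
    qed
    show "summable (\<lambda>n. 1 / (real n + 1)\<^sup>2)"
      using inverse_squares_sums by (auto simp: sums_iff add.commute)
  qed auto
  also have "(\<Sum>n. 1 / (real n + 1)\<^sup>2) = pi\<^sup>2 / 6"
    using inverse_squares_sums by (auto simp: sums_iff add.commute)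
  finally have *: "((\<lambda>t. - (\<Sum>n. a n t)) \<longlongrightarrow> - (pi\<^sup>2 / 6)) (at_right 0)"
    by (rule tendsto_minus)
  have "\<forall>\<^sub>F t in at_right 0. - (\<Sum>n. a n t) = t * ln (qprod 1 t)"
    using eventually_at_right_less[of "0::real"]
  proof eventually_elim
    case (elim t)
    from sums_mult[OF ln_qprod_1[OF elim], of t] show ?case
      unfolding a_def by (simp add: sums_iff mult_ac)
  qed
  with * show ?thesis by (rule Lim_transform_eventually)
qed

text \<open>The relation is iterated along t, t/2, t/4, ... with geometrically decaying weights. By
  itself it is also satisfied by R(t) = c/t; the assumption \<open>small\<close> excludes this and
  makes the remainder of the iteration vanish.\<close>

lemma tendsto_0_of_doubling:
  fixes R :: "real \<Rightarrow> real"
  assumes rec: "((\<lambda>t. R t - R (t / 2) / 2) \<longlongrightarrow> 0) (at_right 0)"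
    and small: "((\<lambda>t. t * R t) \<longlongrightarrow> 0) (at_right 0)"
  shows "(R \<longlongrightarrow> 0) (at_right 0)"
proof (rule tendstoI)
  fix e :: real assume e: "e > 0"
  have "\<forall>\<^sub>F t in at_right 0. \<bar>R t - R (t / 2) / 2\<bar> < e / 4"
    using tendstoD[OF rec, of "e/4"] e by (simp add: dist_real_def)
  then obtain d where d: "d > 0" "\<And>t. 0 < t \<Longrightarrow> t < d \<Longrightarrow> \<bar>R t - R (t / 2) / 2\<bar> < e / 4"
    unfolding eventually_at_right_field by auto
  have "\<bar>R t\<bar> < e" if t: "0 < t" "t < d" for t
  proof -
    \<comment> \<open>The k-th step costs at most e/4 divided by 2^k, and these errors sum to at
      most e/2, strictly below the target \<open>e\<close>.\<close>
    have bnd: "\<bar>R t - R (t / 2 ^ n) / 2 ^ n\<bar> \<le> e / 2 * (1 - 1 / 2 ^ n)" for n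
    proof (induction n)
      case (Suc n)
      have "t / 2 ^ n \<le> t / 1" using t by (intro divide_left_mono) auto
      hence "\<bar>R (t / 2 ^ n) - R (t / 2 ^ n / 2) / 2\<bar> < e / 4" using t by (intro d) auto
      hence "\<bar>R (t / 2 ^ n) - R (t / 2 ^ n / 2) / 2\<bar> / 2 ^ n \<le> e / 4 / 2 ^ n"
        by (intro divide_right_mono) auto
      also have "\<bar>R (t / 2 ^ n) - R (t / 2 ^ n / 2) / 2\<bar> / 2 ^ n =
          \<bar>(R (t / 2 ^ n) - R (t / 2 ^ n / 2) / 2) / 2 ^ n\<bar>" by simp
      also have "(R (t / 2 ^ n) - R (t / 2 ^ n / 2) / 2) / 2 ^ n =
          R (t / 2 ^ n) / 2 ^ n - R (t / 2 ^ Suc n) / 2 ^ Suc n"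
        by (simp add: diff_divide_distrib mult.commute)
      finally have "\<bar>R (t / 2 ^ n) / 2 ^ n - R (t / 2 ^ Suc n) / 2 ^ Suc n\<bar> \<le> e / 4 / 2 ^ n" .
      with Suc have "\<bar>R t - R (t / 2 ^ Suc n) / 2 ^ Suc n\<bar> \<le> e / 2 * (1 - 1 / 2 ^ n) + e / 4 / 2 ^ n"
        by linarith
      also have "\<dots> = e / 2 * (1 - 1 / 2 ^ Suc n)" by (simp add: field_simps)
      finally show ?case .
    qed auto
    have "filterlim (\<lambda>n. t / 2 ^ n) (at_right 0) sequentially"
      using t by real_asymp
    from filterlim_compose[OF small this] have "(\<lambda>n. t / 2 ^ n * R (t / 2 ^ n)) \<longlonglongrightarrow> 0" .
    from tendsto_mult_left[OF this, of "1/t"] have "(\<lambda>n. R (t / 2 ^ n) / 2 ^ n) \<longlonglongrightarrow> 0"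
      using t by (simp add: field_simps)
    hence "(\<lambda>n. \<bar>R t - R (t / 2 ^ n) / 2 ^ n\<bar>) \<longlonglongrightarrow> \<bar>R t - 0\<bar>" by (intro tendsto_intros)
    moreover have "(\<lambda>n. e / 2 * (1 - 1 / 2 ^ n)) \<longlonglongrightarrow> e / 2" by real_asymp
    ultimately have "\<bar>R t - 0\<bar> \<le> e / 2" by (rule LIMSEQ_le) (use bnd in auto)
    thus ?thesis using e by simp
  qed
  thus "\<forall>\<^sub>F t in at_right 0. dist (R t) 0 < e"
    unfolding eventually_at_right_field using d(1) by (auto simp: dist_real_def)
qed

text \<open>In \<open>R t - R (t / 2) / 2\<close> the terms in 1/t cancel, and the logarithmic terms
  combine to a quarter of the logarithm of the quotient in \<open>qprod_ratio_limit\<close>, minus a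
  quarter of ln pi. The leading term of \<open>ln (qprod 1 t)\<close> supplies the other
  condition.\<close>

lemma qprod_1_asymp:
  "((\<lambda>t. ln (qprod 1 t) + pi\<^sup>2 / (6 * t) - ln (2 * pi / t) / 2) \<longlongrightarrow> 0) (at_right 0)"
proof (rule tendsto_0_of_doubling)
  define R where "R t = ln (qprod 1 t) + pi\<^sup>2 / (6 * t) - ln (2 * pi / t) / 2" for t
  have "((\<lambda>t. ln (t * (qprod 1 t / qprod (1/2) t)\<^sup>2) / 4 - ln pi / 4) \<longlongrightarrow> ln pi / 4 - ln pi / 4) (at_right 0)"
    by (intro tendsto_intros qprod_ratio_limit) auto
  moreover have "\<forall>\<^sub>F t in at_right 0. ln (t * (qprod 1 t / qprod (1/2) t)\<^sup>2) / 4 - ln pi / 4 = R t - R (t / 2) / 2"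
    using eventually_at_right_less[of "0::real"]
  proof eventually_elim
    case (elim t)
    have p: "qprod 1 t > 0" "qprod (1/2) t > 0" using qprod_pos elim by auto
    have l: "ln (2 * pi / t) = ln 2 + ln pi - ln t" "ln (2 * pi / (t / 2)) = 2 * ln 2 + ln pi - ln t"
      using elim ln_realpow[of 2 2] by (auto simp: ln_div ln_mult)
    have "ln (qprod 1 (t / 2)) = ln (qprod 1 t) + ln (qprod (1/2) t)"
      using p by (simp add: qprod_1_half[OF elim] ln_mult)
    thus ?case using p elim unfolding R_def l
      by (simp add: ln_mult ln_div ln_realpow field_simps)
  qed
  ultimately show "((\<lambda>t. R t - R (t / 2) / 2) \<longlongrightarrow> 0) (at_right 0)"
    by (auto elim: Lim_transform_eventually)
  have "((\<lambda>t. t * ln (qprod 1 t) + (pi\<^sup>2 / 6 - t * ln (2 * pi / t) / 2)) \<longlongrightarrow> - (pi\<^sup>2 / 6) + pi\<^sup>2 / 6) (at_right 0)"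
    by (intro tendsto_add ln_qprod_1_leading) real_asymp
  moreover have "\<forall>\<^sub>F t in at_right 0. t * ln (qprod 1 t) + (pi\<^sup>2 / 6 - t * ln (2 * pi / t) / 2) = t * R t"
    using eventually_at_right_less[of "0::real"]
    by eventually_elim (auto simp: R_def field_simps)
  ultimately show "((\<lambda>t. t * R t) \<longlongrightarrow> 0) (at_right 0)"
    by (auto elim: Lim_transform_eventually)
qed

section \<open>Laurent coefficients on an annulus\<close>

lemma integral_cis:
  fixes n :: int
  shows "(\<integral>\<theta>. indicator {-pi..pi} \<theta> *\<^sub>R cis (of_int n * \<theta>) \<partial>lborel) = (if n = 0 then 2 * pi else 0)"
proof (cases "n = 0")
  case False
  have "(\<integral>\<theta>. indicator {-pi..pi} \<theta> *\<^sub>R cis (of_int n * \<theta>) \<partial>lborel) =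
      cis (of_int n * pi) / (\<i> * of_int n) - cis (of_int n * (-pi)) / (\<i> * of_int n)"
  proof (rule integral_FTC_Icc)
    fix x :: real
    have "((\<lambda>z. exp (\<i> * of_int n * z) / (\<i> * of_int n)) has_field_derivative
            exp (\<i> * of_int n * of_real x)) (at (of_real x))"
      using False by (auto intro!: derivative_eq_intros)
    from has_vector_derivative_at_within[OF has_vector_derivative_real_field[OF this]]
    show "((\<lambda>\<theta>. cis (of_int n * \<theta>) / (\<i> * of_int n)) has_vector_derivative cis (of_int n * x))
            (at x within {-pi..pi})"
      by (simp add: cis_conv_exp mult.assoc)
  qed (auto intro!: continuous_intros)
  also have "cis (of_int n * pi) = cis (of_int n * (-pi))"
    by (simp add: complex_eq_iff sin_times_pi_eq_0)
  finally show ?thesis using False by simp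
qed (simp add: scaleR_conv_of_real)

text \<open>Absolute convergence on the circle allows termwise integration, and orthogonality of the
  characters isolates one coefficient. As the integral involves only \<open>f\<close>, this also
  proves uniqueness of the expansion.\<close>

lemma laurent_expansion_coeff:
  assumes exp: "is_laurent_expansion r R f c" and \<rho>: "r < \<rho>" "\<rho> < R" "0 < \<rho>"
  shows "c n = (\<integral>\<theta>. indicator {-pi..pi} \<theta> *\<^sub>R
            (f (of_real \<rho> * cis \<theta>) * (of_real \<rho> * cis \<theta>) powi (-n)) \<partial>lborel) / (2 * pi)"
proof -
  \<comment> \<open>Enumerating the integers turns the unordered two-sided sum into an ordinary
    series, the form in which termwise integration is available.\<close>
  define d where "d k = int_decode k" for k
  define b where "b k = c (d k) * of_real (\<rho> powi (d k - n))" for k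
  have sums: "(\<lambda>k. b k * cis (of_int (d k - n) * \<theta>)) sums
      (f (of_real \<rho> * cis \<theta>) * (of_real \<rho> * cis \<theta>) powi (-n))" 
    and abs: "summable (\<lambda>k. norm (b k * cis (of_int (d k - n) * \<theta>)))" for \<theta>
  proof -
    define z where "z = of_real \<rho> * cis \<theta>"
    have z: "norm z = \<rho>" "z \<noteq> 0" unfolding z_def using \<rho> by (auto simp: norm_mult)
    have "((\<lambda>m. c m * z powi m) has_sum f z) UNIV"
      using exp \<rho> z unfolding is_laurent_expansion_def by auto
    hence "((\<lambda>m. c m * z powi m * z powi (-n)) has_sum (f z * z powi (-n))) UNIV"
      by (rule has_sum_cmult_left)
    hence "((\<lambda>k. c (d k) * z powi (d k) * z powi (-n)) has_sum (f z * z powi (-n))) UNIV"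
      unfolding d_def by (subst has_sum_reindex_bij_betw[OF bij_int_decode])
    moreover have "c (d k) * z powi (d k) * z powi (-n) = b k * cis (of_int (d k - n) * \<theta>)" for k
    proof -
      have "z powi (d k) * z powi (-n) = z powi (d k - n)"
        using z by (simp add: power_int_add[symmetric])
      also have "\<dots> = of_real (\<rho> powi (d k - n)) * cis (of_int (d k - n) * \<theta>)"
        unfolding z_def by (simp add: power_int_mult_distrib cis_power_int)
      finally show ?thesis unfolding b_def by (simp add: mult_ac)
    qed
    ultimately have hs: "((\<lambda>k. b k * cis (of_int (d k - n) * \<theta>)) has_sum (f z * z powi (-n))) UNIV"
      by simp
    show "(\<lambda>k. b k * cis (of_int (d k - n) * \<theta>)) sums (f z * z powi (-n))"
      using hs by (rule has_sum_imp_sums)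
    show "summable (\<lambda>k. norm (b k * cis (of_int (d k - n) * \<theta>)))"
      using has_sum_imp_summable[OF hs] unfolding summable_on_iff_abs_summable_on_complex
      by (rule summable_on_imp_summable)
  qed
  \<comment> \<open>At angle 0 all characters equal 1; since they have modulus 1 everywhere, this
    single case gives a majorant for all angles.\<close>
  have sb: "summable (\<lambda>k. norm (b k))" using abs[of 0] by simp
  define h where "h k \<theta> = indicator {-pi..pi} \<theta> *\<^sub>R (b k * cis (of_int (d k - n) * \<theta>))" for k \<theta>
  have int_h: "integral\<^sup>L lborel (h k) = b k * (if d k = n then 2 * pi else 0)" for k
  proof -
    have "h k = (\<lambda>\<theta>. b k * (indicator {-pi..pi} \<theta> *\<^sub>R cis (of_int (d k - n) * \<theta>)))"
      unfolding h_def by (simp add: fun_eq_iff)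
    hence "integral\<^sup>L lborel (h k) =
        b k * (\<integral>\<theta>. indicator {-pi..pi} \<theta> *\<^sub>R cis (of_int (d k - n) * \<theta>) \<partial>lborel)"
      by (simp only: integral_mult_right_zero)
    thus ?thesis unfolding integral_cis by simp
  qed
  have "(\<lambda>k. integral\<^sup>L lborel (h k)) sums (\<integral>\<theta>. (\<Sum>k. h k \<theta>) \<partial>lborel)"
  proof (rule sums_integral)
    show "integrable lborel (h k)" for k
      unfolding h_def
      by (intro borel_integrable_compact continuous_intros) auto
    show "AE \<theta> in lborel. summable (\<lambda>k. norm (h k \<theta>))"
      unfolding h_def by (intro always_eventually allI) (use sb in \<open>simp add: norm_mult summable_mult\<close>)
    have "(\<integral>\<theta>. norm (h k \<theta>) \<partial>lborel) = norm (b k) * (2 * pi)" for k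
      unfolding h_def by (simp add: norm_mult)
    thus "summable (\<lambda>k. \<integral>\<theta>. norm (h k \<theta>) \<partial>lborel)" using sb by (simp add: summable_mult2)
  qed
  moreover have "(\<Sum>k. h k \<theta>) = indicator {-pi..pi} \<theta> *\<^sub>R
            (f (of_real \<rho> * cis \<theta>) * (of_real \<rho> * cis \<theta>) powi (-n))" for \<theta>
    unfolding h_def using sums_scaleR_right[OF sums[of \<theta>], of "indicator {-pi..pi} \<theta>"]
    by (simp add: sums_iff)
  moreover have "(\<lambda>k. integral\<^sup>L lborel (h k)) sums (c n * (2 * pi))"
  proof -
    have "(\<lambda>k. integral\<^sup>L lborel (h k)) = (\<lambda>k. if k = int_encode n then c n * (2 * pi) else 0)"
      unfolding int_h b_def d_def by (auto simp: fun_eq_iff)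
    thus ?thesis using sums_single[of "int_encode n" "\<lambda>_. c n * (2 * pi)"] by simp
  qed
  ultimately have "c n * (2 * pi) = (\<integral>\<theta>. indicator {-pi..pi} \<theta> *\<^sub>R
            (f (of_real \<rho> * cis \<theta>) * (of_real \<rho> * cis \<theta>) powi (-n)) \<partial>lborel)"
    by (simp add: sums_iff)
  thus ?thesis by (simp add: field_simps)
qed

text \<open>An unordered sum requires absolute convergence at \<open>z\<close>. It follows from
  convergence at a point of larger modulus in the disc, taken halfway between \<open>norm z\<close>
  and 1.\<close>

lemma holomorphic_has_sum_power_series:
  assumes "g holomorphic_on ball 0 1" "norm z < 1"
  shows "((\<lambda>n. (deriv ^^ n) g 0 / fact n * z ^ n) has_sum g z) UNIV"
proof (rule norm_summable_imp_has_sum)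
  show "(\<lambda>n. (deriv ^^ n) g 0 / fact n * z ^ n) sums g z"
    using holomorphic_power_series[OF assms(1), of z] assms(2) by simp
  define x where "x = complex_of_real ((norm z + 1) / 2)"
  have x: "norm z < norm x" "norm x < 1" unfolding x_def norm_of_real using assms(2) by auto
  have "summable (\<lambda>n. (deriv ^^ n) g 0 / fact n * x ^ n)"
    using holomorphic_power_series[OF assms(1), of x] x by (auto simp: sums_iff)
  from powser_insidea[OF this x(1)]
  show "summable (\<lambda>n. norm ((deriv ^^ n) g 0 / fact n * z ^ n))" .
qed

text \<open>On the annulus both z and q/z lie in the unit disc, so the Taylor series of the two
  factors can be multiplied and the terms of equal total exponent collected.\<close>

lemma laurent_expansion_exists:
  assumes g: "g holomorphic_on ball 0 1" and h: "h holomorphic_on ball 0 1"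
    and f: "\<And>z. norm q < norm z \<Longrightarrow> norm z < 1 \<Longrightarrow> f z = g z * h (q / z)"
  shows "\<exists>c. is_laurent_expansion (norm q) 1 f c"
proof -
  define a where "a n = (deriv ^^ n) g 0 / fact n" for n
  define b where "b n = (deriv ^^ n) h 0 / fact n" for n
  \<comment> \<open>The index pairs that contribute to \<open>z powi k\<close>. The sum of
    \<open>e\<close> over them does not involve z, so one family \<open>c\<close> serves the whole
    annulus.\<close>
  define A where "A k = {(m, n). int m - int n = k}" for k
  define e where "e = (\<lambda>(m, n). a m * b n * q ^ n)"
  define c where "c k = infsum e (A k)" for k
  have "is_laurent_expansion (norm q) 1 f c"
    unfolding is_laurent_expansion_def
  proof (intro allI impI)
    fix z :: complex assume z: "norm q < norm z \<and> norm z < 1"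
    hence z0: "z \<noteq> 0" by auto
    have qz: "norm (q / z) < 1" using z z0 by (simp add: norm_divide)
    define p where "p = (\<lambda>(m, n). (a m * z ^ m) * (b n * (q / z) ^ n))"
    have sa: "((\<lambda>m. a m * z ^ m) has_sum g z) UNIV"
      unfolding a_def using z by (intro holomorphic_has_sum_power_series g) auto
    have sb: "((\<lambda>n. b n * (q / z) ^ n) has_sum h (q / z)) UNIV"
      unfolding b_def by (intro holomorphic_has_sum_power_series h qz)
    have "p summable_on (UNIV \<times> UNIV)"
    proof -
      have "(\<lambda>m. norm (a m * z ^ m)) summable_on UNIV" "(\<lambda>n. norm (b n * (q / z) ^ n)) summable_on UNIV"
        using has_sum_imp_summable[OF sa] has_sum_imp_summable[OF sb]
        unfolding summable_on_iff_abs_summable_on_complex .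
      hence "(\<lambda>x. norm (p x)) summable_on (UNIV \<times> UNIV)"
        by (intro summable_on_SigmaI[where g = "\<lambda>m. norm (a m * z ^ m) * infsum (\<lambda>n. norm (b n * (q / z) ^ n)) UNIV"])
           (auto simp: p_def norm_mult intro!: has_sum_cmult_right summable_on_cmult_left has_sum_infsum)
      thus ?thesis by (rule abs_summable_summable)
    qed
    moreover have "((\<lambda>n. p (m, n)) has_sum (a m * z ^ m * h (q / z))) UNIV" for m
      unfolding p_def by (auto intro!: has_sum_cmult_right sb)
    moreover have "((\<lambda>m. a m * z ^ m * h (q / z)) has_sum (g z * h (q / z))) UNIV"
      by (intro has_sum_cmult_left sa)
    ultimately have "(p has_sum (g z * h (q / z))) (UNIV \<times> UNIV)"
      by (intro has_sum_SigmaI) auto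
    hence tot: "(p has_sum f z) UNIV" using f z by simp
    \<comment> \<open>The diagonals \<open>A k\<close> partition the grid of index pairs, so the
      double sum may be grouped along them.\<close>
    have bij: "bij_betw snd (Sigma UNIV A) UNIV"
      by (rule bij_betwI[of _ _ _ "\<lambda>x. (int (fst x) - int (snd x), x)"]) (auto simp: A_def)
    have "((\<lambda>x. p (snd x)) has_sum f z) (Sigma UNIV A)"
      using tot by (subst has_sum_reindex_bij_betw[OF bij])
    moreover have "((\<lambda>x. p (snd (k, x))) has_sum (c k * z powi k)) (A k)" for k
    proof -
      have pe: "p x = e x * z powi k" if "x \<in> A k" for x
      proof -
        obtain m n where x: "x = (m, n)" by force
        hence k: "k = int m - int n" using that by (simp add: A_def)
        show ?thesis using z0 unfolding x p_def e_def k
          by (simp add: power_int_diff power_divide field_simps)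
      qed
      have "p summable_on A k"
        using has_sum_imp_summable[OF tot] by (rule summable_on_subset_banach) auto
      hence "(\<lambda>x. e x * z powi k) summable_on A k"
        using pe by (subst (asm) summable_on_cong) auto
      \<comment> \<open>Removing the nonzero factor shows that \<open>e\<close> itself is summable
        on the diagonal, so \<open>c k\<close> is a genuine sum and not the default value 0 of
        \<open>infsum\<close>.\<close>
      hence "(\<lambda>x. e x * z powi k * z powi (-k)) summable_on A k"
        by (rule summable_on_cmult_left)
      hence "e summable_on A k" using z0 by (simp add: power_int_minus mult.assoc)
      hence "((\<lambda>x. e x * z powi k) has_sum (c k * z powi k)) (A k)"
        unfolding c_def by (intro has_sum_cmult_left has_sum_infsum)
      thus ?thesis using pe by (subst has_sum_cong[of _ _ "\<lambda>x. e x * z powi k"]) auto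
    qed
    ultimately show "((\<lambda>n. c n * z powi n) has_sum f z) UNIV"
      by (intro has_sum_Sigma'[where f = "\<lambda>x. p (snd x)" and B = A]) auto
  qed
  thus ?thesis by blast
qed

text \<open>An expansion exists, and the integral formula determines its coefficients; hence the
  definite description in \<open>laurent_coeff\<close> denotes it.\<close>

lemma laurent_coeff_eq_integral:
  assumes "g holomorphic_on ball 0 1" "h holomorphic_on ball 0 1"
    and "\<And>z. norm q < norm z \<Longrightarrow> norm z < 1 \<Longrightarrow> f z = g z * h (q / z)"
    and \<rho>: "norm q < \<rho>" "\<rho> < 1"
  shows "laurent_coeff (norm q) 1 f n = (\<integral>\<theta>. indicator {-pi..pi} \<theta> *\<^sub>R
            (f (of_real \<rho> * cis \<theta>) * (of_real \<rho> * cis \<theta>) powi (-n)) \<partial>lborel) / (2 * pi)"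
proof -
  have \<rho>0: "0 < \<rho>" using \<rho>(1) norm_ge_zero[of q] by linarith
  obtain c where c: "is_laurent_expansion (norm q) 1 f c"
    using laurent_expansion_exists[OF assms(1-3)] by blast
  have "laurent_coeff (norm q) 1 f = c" unfolding laurent_coeff_def
  proof (rule the_equality)
    show "is_laurent_expansion (norm q) 1 f c" by (rule c)
    fix c' assume c': "is_laurent_expansion (norm q) 1 f c'"
    show "c' = c"
      by (rule ext) (simp only: laurent_expansion_coeff[OF c \<rho> \<rho>0] laurent_expansion_coeff[OF c' \<rho> \<rho>0])
  qed
  thus ?thesis using laurent_expansion_coeff[OF c \<rho> \<rho>0] by simp
qed

section \<open>Integrals of powers of the hyperbolic secant\<close>

text \<open>For a nonnegative integrand, finite limits of the antiderivative at both ends already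
  force integrability.\<close>

lemma
  fixes g G :: "real \<Rightarrow> real"
  assumes "\<And>x. (G has_real_derivative g x) (at x)" "\<And>x. isCont g x" "\<And>x. g x \<ge> 0"
    and "(G \<longlongrightarrow> A) at_bot" "(G \<longlongrightarrow> B) at_top"
  shows integrable_FTC_real_line: "integrable lborel g"
    and integral_FTC_real_line_nonneg: "integral\<^sup>L lborel g = B - A"
proof -
  have "set_integrable lborel (einterval (-\<infinity>) \<infinity>) g" "(LBINT x=-\<infinity>..\<infinity>. g x) = B - A"
    by (rule interval_integral_FTC_nonneg[where F = G];
        use assms in \<open>simp add: ereal_tendsto_simps\<close>)+
  thus "integrable lborel g" "integral\<^sup>L lborel g = B - A"
    by (simp_all add: set_integrable_def interval_lebesgue_integral_def set_lebesgue_integral_def)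
qed

text \<open>Here the integrand may change sign, as it does in the recursion for powers of the
  hyperbolic secant, so integrability is assumed.\<close>

lemma integral_FTC_real_line:
  fixes g G :: "real \<Rightarrow> real"
  assumes "\<And>x. (G has_real_derivative g x) (at x)" "\<And>x. isCont g x" "integrable lborel g"
    and "(G \<longlongrightarrow> A) at_bot" "(G \<longlongrightarrow> B) at_top"
  shows "integral\<^sup>L lborel g = B - A"
proof -
  have "(LBINT x=-\<infinity>..\<infinity>. g x) = B - A"
    by (rule interval_integral_FTC_integrable[where F = G];
        use assms in \<open>simp add: ereal_tendsto_simps set_integrable_def has_real_derivative_iff_has_vector_derivative\<close>)
  thus ?thesis
    by (simp add: interval_lebesgue_integral_def set_lebesgue_integral_def)
qed

lemma
  shows integrable_sech: "integrable lborel (\<lambda>u. 1 / cosh (pi * u))"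
    and integral_sech: "(\<integral>u. 1 / cosh (pi * u) \<partial>lborel) = 1"
proof -
  \<comment> \<open>Up to scaling and an additive constant this antiderivative is the Gudermannian
    function.\<close>
  have d: "((\<lambda>u. 2 / pi * arctan (exp (pi * u))) has_real_derivative 1 / cosh (pi * u)) (at u)" for u
  proof -
    have "((\<lambda>u. 2 / pi * arctan (exp (pi * u))) has_real_derivative
        2 / pi * (inverse (1 + (exp (pi * u))\<^sup>2) * (exp (pi * u) * pi))) (at u)"
      by (auto intro!: derivative_eq_intros)
    moreover have "2 / pi * (inverse (1 + (exp (pi * u))\<^sup>2) * (exp (pi * u) * pi)) = 1 / cosh (pi * u)"
    proof -
      have "1 + (exp (pi * u))\<^sup>2 > 0" by (simp add: add_pos_nonneg)
      thus ?thesis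
        by (simp add: cosh_field_def exp_minus field_simps power2_eq_square)
    qed
    ultimately show ?thesis by simp
  qed
  have lim: "((\<lambda>u. 2 / pi * arctan (exp (pi * u))) \<longlongrightarrow> 0) at_bot"
    "((\<lambda>u. 2 / pi * arctan (exp (pi * u))) \<longlongrightarrow> 1) at_top"
  proof -
    have "((\<lambda>u. 2 / pi * arctan (exp (pi * u))) \<longlongrightarrow> 2 / pi * 0) at_bot"
      by (intro tendsto_mult tendsto_const) real_asymp
    thus "((\<lambda>u. 2 / pi * arctan (exp (pi * u))) \<longlongrightarrow> 0) at_bot" by simp
    have "((\<lambda>u. 2 / pi * arctan (exp (pi * u))) \<longlongrightarrow> 2 / pi * (pi / 2)) at_top"
      by (intro tendsto_mult tendsto_const) real_asymp
    thus "((\<lambda>u. 2 / pi * arctan (exp (pi * u))) \<longlongrightarrow> 1) at_top" by simp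
  qed
  have c: "isCont (\<lambda>u. 1 / cosh (pi * u)) x" for x
    by (auto intro!: continuous_intros)
  show "integrable lborel (\<lambda>u. 1 / cosh (pi * u))"
    by (rule integrable_FTC_real_line[OF d c _ lim]) simp
  show "(\<integral>u. 1 / cosh (pi * u) \<partial>lborel) = 1"
    by (subst integral_FTC_real_line_nonneg[OF d c _ lim]) auto
qed

lemma integrable_sech_power:
  assumes "n \<ge> 1" shows "integrable lborel (\<lambda>u. 1 / cosh (pi * u) ^ n)"
proof (rule Bochner_Integration.integrable_bound[OF integrable_sech])
  show "(\<lambda>u. 1 / cosh (pi * u) ^ n) \<in> borel_measurable lborel"
    unfolding measurable_lborel2 by (intro borel_measurable_continuous_onI continuous_intros) auto
  have "cosh (pi * u) ^ 1 \<le> cosh (pi * u) ^ n" for u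
    using assms by (intro power_increasing) (auto simp: cosh_real_ge_1)
  thus "AE u in lborel. norm (1 / cosh (pi * u) ^ n) \<le> norm (1 / cosh (pi * u))"
    by (intro always_eventually allI) (auto simp: divide_simps)
qed

lemma tanh_real_derivative_pi:
  "((\<lambda>u. tanh (pi * u)) has_real_derivative pi * (1 - (tanh (pi * u))\<^sup>2)) (at u)"
  by (auto intro!: derivative_eq_intros)

text \<open>The function \<open>g\<close> is the derivative of sinh / cosh^(n+1) at pi u, simplified
  by sinh^2 = cosh^2 - 1. For \<open>n \<ge> 1\<close> this quotient is bounded by 1 / cosh, so its
  boundary values vanish.\<close>

lemma integral_sech_power_rec:
  assumes "n \<ge> 1"
  shows "(real n + 1) * (\<integral>u. 1 / cosh (pi * u) ^ (n + 2) \<partial>lborel) =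
         real n * (\<integral>u. 1 / cosh (pi * u) ^ n \<partial>lborel)"
proof -
  define g where "g u = pi * ((real n + 1) * (1 / cosh (pi * u) ^ (n + 2)) - real n * (1 / cosh (pi * u) ^ n))"
    for u
  have i: "integrable lborel (\<lambda>u. 1 / cosh (pi * u) ^ (n + 2))" "integrable lborel (\<lambda>u. 1 / cosh (pi * u) ^ n)"
    using assms by (intro integrable_sech_power; simp)+
  have ig: "integrable lborel g" unfolding g_def using i by (intro integrable_mult_right Bochner_Integration.integrable_diff)
  have "integral\<^sup>L lborel g = 0 - 0"
  proof (rule integral_FTC_real_line[OF _ _ ig])
    fix u :: real
    show "isCont g u" unfolding g_def by (auto intro!: continuous_intros)
    define c s where "c = cosh (pi * u)" and "s = sinh (pi * u)"
    have c0: "c > 0" and cs: "s\<^sup>2 = c\<^sup>2 - 1"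
      unfolding c_def s_def by (auto simp: sinh_square_eq)
    have d1: "((\<lambda>u. cosh (pi * u) ^ Suc n) has_real_derivative
        (1 + real n) * (sinh (pi * u) * pi * cosh (pi * u) ^ n)) (at u)"
      by (rule DERIV_power_Suc) (auto intro!: derivative_eq_intros)
    have d2: "((\<lambda>u. sinh (pi * u)) has_real_derivative cosh (pi * u) * pi) (at u)"
      by (auto intro!: derivative_eq_intros)
    have "((\<lambda>u. sinh (pi * u) / cosh (pi * u) ^ (n + 1)) has_real_derivative
        ((cosh (pi * u) * pi) * cosh (pi * u) ^ (n + 1) - sinh (pi * u) * (real (n + 1) * (sinh (pi * u) * pi) * cosh (pi * u) ^ n)) /
          (cosh (pi * u) ^ (n + 1) * cosh (pi * u) ^ (n + 1))) (at u)"
      using DERIV_divide[OF d2 d1] by (simp add: mult.assoc)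
    also have "((cosh (pi * u) * pi) * cosh (pi * u) ^ (n + 1) - sinh (pi * u) * (real (n + 1) * (sinh (pi * u) * pi) * cosh (pi * u) ^ n)) /
          (cosh (pi * u) ^ (n + 1) * cosh (pi * u) ^ (n + 1)) = g u"
    proof -
      have "(c * pi) * c ^ (n + 1) - s * (real (n + 1) * (s * pi) * c ^ n) = pi * c ^ n * (c\<^sup>2 - (real n + 1) * s\<^sup>2)"
        by (simp add: power2_eq_square algebra_simps)
      also have "\<dots> = pi * c ^ n * ((real n + 1) - real n * c\<^sup>2)" unfolding cs by (simp add: algebra_simps)
      finally have *: "(c * pi) * c ^ (n + 1) - s * (real (n + 1) * (s * pi) * c ^ n) = pi * c ^ n * ((real n + 1) - real n * c\<^sup>2)" .
      show ?thesis unfolding g_def c_def[symmetric] s_def[symmetric] * using c0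
        by (simp add: field_simps power2_eq_square)
    qed
    finally show "((\<lambda>u. sinh (pi * u) / cosh (pi * u) ^ (n + 1)) has_real_derivative g u) (at u)" .
  next
    have inv: "((\<lambda>u. 1 / cosh (pi * u)) \<longlongrightarrow> 0) at_bot" "((\<lambda>u. 1 / cosh (pi * u)) \<longlongrightarrow> 0) at_top"
      by real_asymp+
    have bnd: "norm (sinh (pi * u) / cosh (pi * u) ^ (n + 1)) \<le> 1 / cosh (pi * u)" for u
    proof -
      have "\<bar>sinh (pi * u)\<bar> \<le> cosh (pi * u)"
        using sinh_le_cosh_real[of "pi * u"] sinh_le_cosh_real[of "- (pi * u)"] by simp
      moreover have "cosh (pi * u) ^ 1 \<le> cosh (pi * u) ^ n"
        using assms by (intro power_increasing) (auto simp: cosh_real_ge_1)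
      ultimately have "\<bar>sinh (pi * u)\<bar> * cosh (pi * u) \<le> cosh (pi * u) * cosh (pi * u) ^ n"
        by (intro mult_mono) auto
      thus ?thesis by (simp add: field_simps)
    qed
    show "((\<lambda>u. sinh (pi * u) / cosh (pi * u) ^ (n + 1)) \<longlongrightarrow> 0) at_bot"
      by (rule Lim_null_comparison[OF _ inv(1)]) (use bnd in auto)
    show "((\<lambda>u. sinh (pi * u) / cosh (pi * u) ^ (n + 1)) \<longlongrightarrow> 0) at_top"
      by (rule Lim_null_comparison[OF _ inv(2)]) (use bnd in auto)
  qed
  moreover have "integral\<^sup>L lborel g = pi * ((real n + 1) * (\<integral>u. 1 / cosh (pi * u) ^ (n + 2) \<partial>lborel) -
      real n * (\<integral>u. 1 / cosh (pi * u) ^ n \<partial>lborel))"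
    unfolding g_def using i
    by (simp only: integral_mult_right_zero Bochner_Integration.integral_diff integrable_mult_right)
  ultimately show ?thesis by simp
qed

lemma integral_sech_power_2: "(\<integral>u. 1 / cosh (pi * u) ^ 2 \<partial>lborel) = 2 / pi"
proof -
  have "(\<integral>u. 1 / cosh (pi * u) ^ 2 \<partial>lborel) = 1 / pi - (- 1 / pi)"
  proof (rule integral_FTC_real_line[OF _ _ integrable_sech_power])
    fix u :: real
    show "isCont (\<lambda>u. 1 / cosh (pi * u) ^ 2) u" by (auto intro!: continuous_intros)
    have "((\<lambda>u. tanh (pi * u) / pi) has_real_derivative pi * (1 - (tanh (pi * u))\<^sup>2) / pi) (at u)"
      by (intro DERIV_cdivide tanh_real_derivative_pi)
    moreover have "pi * (1 - (tanh (pi * u))\<^sup>2) / pi = 1 / cosh (pi * u) ^ 2"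
    proof -
      have "1 - (tanh (pi * u))\<^sup>2 = ((cosh (pi * u))\<^sup>2 - (sinh (pi * u))\<^sup>2) / (cosh (pi * u))\<^sup>2"
        by (simp add: tanh_def power_divide diff_divide_distrib)
      thus ?thesis by (simp add: sinh_square_eq)
    qed
    ultimately show "((\<lambda>u. tanh (pi * u) / pi) has_real_derivative 1 / cosh (pi * u) ^ 2) (at u)" by simp
  next
    have lim: "((\<lambda>u. tanh (pi * u)) \<longlongrightarrow> 1) at_top" "((\<lambda>u. tanh (pi * u)) \<longlongrightarrow> -1) at_bot"
      by (real_asymp simp: tanh_def sinh_field_def cosh_field_def)+
    show "((\<lambda>u. tanh (pi * u) / pi) \<longlongrightarrow> 1 / pi) at_top" "((\<lambda>u. tanh (pi * u) / pi) \<longlongrightarrow> - 1 / pi) at_bot"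
      by (intro tendsto_divide tendsto_const lim; simp)+
  qed auto
  thus ?thesis by simp
qed

text \<open>Both sides obey the recursion in steps of two, with base cases 1 and 2. From m to m + 2
  the factorial gains (m+1) m, the squared Gamma value gains ((m+1)/2)^2 and the power of two gains
  4, which together give m / (m+1).\<close>

lemma integral_sech_power:
  assumes "n \<ge> 1"
  shows "(\<integral>u. 1 / cosh (pi * u) ^ n \<partial>lborel) = 2 ^ n * C_const n"
proof -
  have C: "2 ^ n * C_const n = 2 * fact (n - 1) / (2 ^ n * Gamma ((real n + 1) / 2) ^ 2)" for n
    unfolding C_const_def
    by (simp add: power_int_diff power_int_mult power_mult_distrib power2_eq_square field_simps)
  show ?thesis using assms
  proof (induction n rule: less_induct)
    case (less n)
    consider "n = 1" | "n = 2" | m where "n = m + 2" "m \<ge> 1"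
      using less.prems by (metis One_nat_def Suc_1 add.commute add_2_eq_Suc' le_Suc_ex le_antisym
          not_less_eq_eq plus_1_eq_Suc)
    thus ?case
    proof cases
      case 1
      thus ?thesis unfolding C using integral_sech by simp
    next
      case 2
      have G: "Gamma (3/2 :: real) = sqrt pi / 2"
        using Gamma_plus1[of "1/2::real"] nonpos_Ints_nonpos[of "1/2::real"] by (force simp add: Gamma_one_half_real)
      have "2 * fact (2 - 1) / (2 ^ 2 * Gamma ((real 2 + 1) / 2) ^ 2) = 2 / pi"
        by (simp add: G power_divide)
      thus ?thesis unfolding C 2 using integral_sech_power_2 by simp
    next
      case 3
      let ?I = "\<lambda>n. (\<integral>u. 1 / cosh (pi * u) ^ n \<partial>lborel)"
      have IH: "?I m = 2 ^ m * C_const m" using less.IH[of m] 3 by simp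
      have "?I n = real m / (real m + 1) * ?I m"
        using integral_sech_power_rec[OF 3(2)] unfolding 3(1) by (simp add: field_simps)
      also have "\<dots> = real m / (real m + 1) * (2 * fact (m - 1) / (2 ^ m * Gamma ((real m + 1) / 2) ^ 2))"
        unfolding IH C ..
      also have "\<dots> = 2 ^ n * C_const n"
      proof -
        define g where "g = Gamma ((real m + 1) / 2)"
        have "(real m + 1) / 2 \<notin> \<int>\<^sub>\<le>\<^sub>0" using nonpos_Ints_nonpos[of "(real m + 1) / 2"] by force
        hence G: "Gamma ((real n + 1) / 2) = (real m + 1) / 2 * g"
          using Gamma_plus1[of "(real m + 1) / 2"] 3(1) unfolding g_def
          by (simp add: add_divide_distrib)
        have fc: "fact (n - 1) = (real m + 1) * (real m * fact (m - 1))"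
          using 3 by (cases m) (auto simp: algebra_simps)
        have p2: "(2::real) ^ n = 4 * 2 ^ m" unfolding 3(1) by simp
        have "g > 0" unfolding g_def by (intro Gamma_real_pos) auto
        have "real m / r * (2 * f / (p * g\<^sup>2)) = 2 * (r * (real m * f)) / (4 * p * (r / 2 * g)\<^sup>2)"
          if "r > 0" "p > 0" for r f p :: real
          using that \<open>g > 0\<close> by (simp add: power2_eq_square mult_ac)
        from this[of "real m + 1" "2 ^ m"] show ?thesis
          unfolding C[of n] unfolding G fc p2 g_def[symmetric] by simp
      qed
      finally show ?thesis .
    qed
  qed
qed

section \<open>The theta quotient\<close>

text \<open>Euler's sine product at the imaginary argument i x.\<close>

lemma sinh_product_formula:
  fixes x :: real
  assumes "x \<noteq> 0"
  shows "(\<lambda>n. \<Prod>k=1..n. 1 + x\<^sup>2 / (real k)\<^sup>2) \<longlonglongrightarrow> sinh (pi * x) / (pi * x)"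
proof -
  have "(\<lambda>n. complex_of_real pi * (\<i> * x) * (\<Prod>k=1..n. 1 - (\<i> * x)\<^sup>2 / (of_nat k)\<^sup>2)) \<longlonglongrightarrow> sin (pi * (\<i> * x))"
    by (rule sin_product_formula_complex)
  hence "(\<lambda>n. -\<i> * (complex_of_real pi * (\<i> * x) * (\<Prod>k=1..n. 1 - (\<i> * x)\<^sup>2 / (of_nat k)\<^sup>2))) \<longlonglongrightarrow>
      -\<i> * sin (pi * (\<i> * x))"
    by (rule tendsto_mult_left)
  also have "-\<i> * sin (pi * (\<i> * x)) = complex_of_real (sinh (pi * x))"
  proof -
    have "sinh (complex_of_real (pi * x)) = complex_of_real (sinh (pi * x))"
      unfolding sinh_field_def of_real_minus[symmetric] exp_of_real by simp
    thus ?thesis using sinh_conv_sin[of "complex_of_real (pi * x)"] by (simp add: mult_ac)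
  qed
  also have "(\<lambda>n. -\<i> * (complex_of_real pi * (\<i> * x) * (\<Prod>k=1..n. 1 - (\<i> * x)\<^sup>2 / (of_nat k)\<^sup>2))) =
     (\<lambda>n. complex_of_real (pi * x * (\<Prod>k=1..n. 1 + x\<^sup>2 / (real k)\<^sup>2)))"
  proof -
    have "-\<i> * (a * (\<i> * b) * P) = a * b * P" for a b P :: complex
      using i_squared by algebra
    thus ?thesis by (simp only: power_mult_distrib) simp
  qed
  finally have "(\<lambda>n. pi * x * (\<Prod>k=1..n. 1 + x\<^sup>2 / (real k)\<^sup>2)) \<longlonglongrightarrow> sinh (pi * x)"
    by (simp only: tendsto_of_real_iff)
  from tendsto_divide[OF this tendsto_const, of "pi * x"] assms show ?thesis by simp
qed

text \<open>Since cosh y = sinh (2y) / (2 sinh y), it suffices to divide the products for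
  \<open>2 * x\<close> and \<open>x\<close>: the even indices of the former reproduce the latter,
  and the odd ones leave the half-integers.\<close>

lemma prodinf_cosh: "(\<Prod>j. 1 + x\<^sup>2 / (real j + 1/2)\<^sup>2) = cosh (pi * x)" for x :: real
proof (cases "x = 0")
  case False
  define S where "S y n = (\<Prod>k=1..n. 1 + y\<^sup>2 / (real k)\<^sup>2)" for y :: real and n :: nat
  have split: "S (2 * x) (2 * n) = S x n * (\<Prod>j<n. 1 + x\<^sup>2 / (real j + 1/2)\<^sup>2)" for n
  proof (induction n)
    case (Suc n)
    have "(2 * x)\<^sup>2 / (real (Suc (2 * n)))\<^sup>2 = x\<^sup>2 / (real n + 1/2)\<^sup>2"
    proof -
      have "real (Suc (2 * n)) = 2 * (real n + 1/2)" by simp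
      thus ?thesis by (simp only: power_mult_distrib) simp
    qed
    moreover have "(2 * x)\<^sup>2 / (real (Suc (Suc (2 * n))))\<^sup>2 = x\<^sup>2 / (real (Suc n))\<^sup>2"
    proof -
      have "real (Suc (Suc (2 * n))) = 2 * real (Suc n)" by simp
      thus ?thesis by (simp only: power_mult_distrib) simp
    qed
    ultimately have "S (2 * x) (2 * Suc n) =
        S (2 * x) (2 * n) * (1 + x\<^sup>2 / (real n + 1/2)\<^sup>2) * (1 + x\<^sup>2 / (real (Suc n))\<^sup>2)"
      unfolding S_def by (simp only: mult_Suc_right add_2_eq_Suc) (simp add: prod.nat_ivl_Suc' mult_ac)
    thus ?case unfolding Suc by (simp add: S_def prod.nat_ivl_Suc' mult_ac)
  qed (simp add: S_def)
  have S_pos: "S x n > 0" for n unfolding S_def by (intro prod_pos) (auto intro!: add_pos_nonneg)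
  have "S (2 * x) \<longlonglongrightarrow> sinh (pi * (2 * x)) / (pi * (2 * x))"
    using sinh_product_formula[of "2 * x"] False unfolding S_def by simp
  from LIMSEQ_subseq_LIMSEQ[OF this, of "\<lambda>n. 2 * n"]
  have "(\<lambda>n. S (2 * x) (2 * n)) \<longlonglongrightarrow> sinh (pi * (2 * x)) / (pi * (2 * x))"
    by (simp add: strict_mono_def o_def)
  moreover have "S x \<longlonglongrightarrow> sinh (pi * x) / (pi * x)"
    using sinh_product_formula[OF False] unfolding S_def .
  ultimately have "(\<lambda>n. S (2 * x) (2 * n) / S x n) \<longlonglongrightarrow>
      (sinh (pi * (2 * x)) / (pi * (2 * x))) / (sinh (pi * x) / (pi * x))"
    using False by (intro tendsto_divide) auto
  also have "(\<lambda>n. S (2 * x) (2 * n) / S x n) = (\<lambda>n. \<Prod>j<n. 1 + x\<^sup>2 / (real j + 1/2)\<^sup>2)"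
    unfolding split using S_pos by (auto simp: fun_eq_iff less_imp_neq[symmetric])
  also have "(sinh (pi * (2 * x)) / (pi * (2 * x))) / (sinh (pi * x) / (pi * x)) = cosh (pi * x)"
    using False sinh_double[of "pi * x"] by (simp add: field_simps)
  finally show ?thesis by (rule prodinf_eq_prod_lim') (simp add: less_imp_neq[symmetric])
qed simp

section \<open>The normalised theta quotient: bounds, limit and integral\<close>

text \<open>The denominator product on the circle of radius \<open>exp (- (t / 2))\<close>,
  normalised to 1 at \<open>\<theta> = 0\<close>; \<open>qpoch_inf_circle\<close> gives the
  connection.\<close>

definition theta_ratio :: "real \<Rightarrow> real \<Rightarrow> real" where
  "theta_ratio t \<theta> = (\<Prod>j. 1 + (sin (\<theta> / 2))\<^sup>2 / (sinh (t * (real j + 1/2) / 2))\<^sup>2)"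

text \<open>By |sin y| \<le> |y| and sinh y \<ge> y for y \<ge> 0, each term is dominated by its own
  limit as t tends to 0, which is summable in \<open>j\<close>.\<close>

lemma theta_ratio_summand_le:
  assumes "t > 0"
  shows "(sin (t * u / 2))\<^sup>2 / (sinh (t * (real j + 1/2) / 2))\<^sup>2 \<le> u\<^sup>2 / (real j + 1/2)\<^sup>2"
proof -
  define c where "c = real j + 1/2"
  have c: "c > 0" unfolding c_def by simp
  have "\<bar>sin (t * u / 2)\<bar> \<le> \<bar>t * u / 2\<bar>" by (rule abs_sin_x_le_abs_x)
  moreover have "t * c / 2 \<le> sinh (t * c / 2)" using assms c by (intro sinh_ge_self) auto
  ultimately have "\<bar>sin (t * u / 2)\<bar> / sinh (t * c / 2) \<le> \<bar>t * u / 2\<bar> / (t * c / 2)"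
    using assms c by (intro frac_le) auto
  also have "\<dots> = \<bar>u\<bar> / c" using assms by (simp add: abs_mult)
  finally have "(\<bar>sin (t * u / 2)\<bar> / sinh (t * c / 2))\<^sup>2 \<le> (\<bar>u\<bar> / c)\<^sup>2"
    using assms c by (intro power_mono) auto
  thus ?thesis unfolding c_def[symmetric] by (simp add: power_divide)
qed

lemma summable_inverse_half_squares: "summable (\<lambda>j. x / (real j + 1/2)\<^sup>2)" for x :: real
proof -
  have "summable (\<lambda>j. 4 * (1 / (real j + 1)\<^sup>2))"
    using inverse_squares_sums by (intro summable_mult) (auto simp: sums_iff add.commute)
  hence "summable (\<lambda>j. 1 / (real j + 1/2)\<^sup>2)"
  proof (rule summable_comparison_test')
    fix j :: nat
    have "((real j + 1) / 2)\<^sup>2 \<le> (real j + 1/2)\<^sup>2" by (intro power_mono) auto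
    hence "1 / (real j + 1/2)\<^sup>2 \<le> 1 / ((real j + 1) / 2)\<^sup>2"
      by (intro divide_left_mono) (auto intro!: mult_pos_pos add_nonneg_pos)
    thus "norm (1 / (real j + 1/2)\<^sup>2) \<le> 4 * (1 / (real j + 1)\<^sup>2)" by (simp add: power_divide)
  qed
  from summable_mult[OF this, of x] show ?thesis by simp
qed

lemma has_prod_theta_ratio:
  assumes "t > 0"
  shows "(\<lambda>j. 1 + (sin (\<theta> / 2))\<^sup>2 / (sinh (t * (real j + 1/2) / 2))\<^sup>2) has_prod theta_ratio t \<theta>"
  unfolding theta_ratio_def
proof (intro convergent_prod_has_prod convergent_prod_one_plus)
  show "summable (\<lambda>j. (\<theta> / t)\<^sup>2 / (real j + 1/2)\<^sup>2)" by (rule summable_inverse_half_squares)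
  show "\<bar>(sin (\<theta> / 2))\<^sup>2 / (sinh (t * (real j + 1/2) / 2))\<^sup>2\<bar> \<le> (\<theta> / t)\<^sup>2 / (real j + 1/2)\<^sup>2" for j
    using theta_ratio_summand_le[OF assms, of "\<theta> / t" j] assms by simp
  have "0 \<le> (sin (\<theta> / 2))\<^sup>2 / (sinh (t * (real j + 1/2) / 2))\<^sup>2" for j by simp
  thus "- 1 / 2 \<le> (sin (\<theta> / 2))\<^sup>2 / (sinh (t * (real j + 1/2) / 2))\<^sup>2" for j
    by (rule order_trans[rotated]) simp
qed

lemma theta_ratio_measurable:
  assumes "t > 0"
  shows "(\<lambda>u. theta_ratio t (t * u)) \<in> borel_measurable borel"
proof (rule borel_measurable_LIMSEQ_real)
  show "(\<lambda>n. \<Prod>j<n. 1 + (sin (t * u / 2))\<^sup>2 / (sinh (t * (real j + 1/2) / 2))\<^sup>2) \<longlonglongrightarrow> theta_ratio t (t * u)" for u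
    by (intro has_prod_imp_tendsto' has_prod_theta_ratio assms)
  show "(\<lambda>u. \<Prod>j<n. 1 + (sin (t * u / 2))\<^sup>2 / (sinh (t * (real j + 1/2) / 2))\<^sup>2) \<in> borel_measurable borel" for n
    by (intro borel_measurable_continuous_onI continuous_intros) (use assms in auto)
qed

text \<open>Up to pi/3 the derivative of the sine is at least 1/2; beyond, the sine is at least sqrt
  3 / 2, which exceeds the largest value pi/4 of \<open>x / 2\<close>.\<close>

lemma half_le_sin:
  fixes x :: real
  assumes "0 \<le> x" "x \<le> pi / 2"
  shows "x / 2 \<le> sin x"
proof (cases "x \<le> pi / 3")
  case True
  have "sin 0 - 0 / 2 \<le> sin x - x / 2"
  proof (rule DERIV_nonneg_imp_nondecreasing[OF assms(1)])
    fix y assume y: "0 \<le> y" "y \<le> x"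
    have "cos (pi / 3) \<le> cos y" using y True by (intro cos_monotone_0_pi_le) auto
    hence "0 \<le> cos y - 1 / 2" by (simp add: cos_60)
    moreover have "((\<lambda>x. sin x - x / 2) has_real_derivative cos y - 1 / 2) (at y)"
      by (auto intro!: derivative_eq_intros)
    ultimately show "\<exists>d. ((\<lambda>x. sin x - x / 2) has_real_derivative d) (at y) \<and> 0 \<le> d" by blast
  qed
  thus ?thesis by simp
next
  case False
  have "sin (pi / 3) \<le> sin x" using False assms by (intro sin_monotone_2pi_le) auto
  moreover have "1.7 \<le> sqrt 3" by (rule real_le_rsqrt) (simp add: power2_eq_square)
  ultimately show ?thesis using assms pi_approx by (simp add: sin_60)
qed

text \<open>On this range cosh y \<le> exp y \<le> 1 + 1/4 + 1/16 < 2. The range is that of t/4 for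
  t at most 1.\<close>

lemma sinh_le_double:
  fixes x :: real
  assumes "0 \<le> x" "x \<le> 1 / 4"
  shows "sinh x \<le> 2 * x"
proof -
  have "2 * 0 - sinh 0 \<le> 2 * x - sinh x"
  proof (rule DERIV_nonneg_imp_nondecreasing[OF assms(1)])
    fix y assume y: "0 \<le> y" "y \<le> x"
    have "cosh y \<le> exp y" using y cosh_plus_sinh[of y] sinh_real_nonneg_iff[of y] by linarith
    moreover have "exp y \<le> 1 + y + y\<^sup>2" using y assms by (intro exp_bound) auto
    moreover have "y\<^sup>2 \<le> (1/4)\<^sup>2" using y assms by (intro power_mono) auto
    hence "y\<^sup>2 \<le> 1/16" by (simp add: power2_eq_square)
    ultimately have "0 \<le> 2 - cosh y" using y assms by linarith
    moreover have "((\<lambda>x. 2 * x - sinh x) has_real_derivative 2 - cosh y) (at y)"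
      by (auto intro!: derivative_eq_intros)
    ultimately show "\<exists>d. ((\<lambda>x. 2 * x - sinh x) has_real_derivative d) (at y) \<and> 0 \<le> d" by blast
  qed
  thus ?thesis by simp
qed

text \<open>All factors are at least 1, so the first alone is a lower bound. There |sin (t u / 2)|
  is at least |t u| / 4 and sinh (t / 4) at most t / 2. The reciprocal of the bound is an integrable
  majorant independent of \<open>t\<close>.\<close>

lemma theta_ratio_ge:
  assumes "0 < t" "t \<le> 1" "\<bar>t * u\<bar> \<le> pi"
  shows "theta_ratio t (t * u) \<ge> 1 + u\<^sup>2 / 4"
proof -
  have "(\<Prod>j<1. 1 + (sin (t * u / 2))\<^sup>2 / (sinh (t * (real j + 1/2) / 2))\<^sup>2) \<le> theta_ratio t (t * u)"
    unfolding theta_ratio_def using has_prod_theta_ratio[OF assms(1), of "t * u"]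
    by (intro prod_le_prodinf[of _ "theta_ratio t (t * u)"]) (auto simp: theta_ratio_def intro: add_nonneg_nonneg)
  hence "1 + (sin (t * u / 2))\<^sup>2 / (sinh (t / 4))\<^sup>2 \<le> theta_ratio t (t * u)" by simp
  moreover have "u\<^sup>2 / 4 \<le> (sin (t * u / 2))\<^sup>2 / (sinh (t / 4))\<^sup>2"
  proof -
    define x where "x = \<bar>t * u / 2\<bar>"
    have x: "0 \<le> x" "x \<le> pi / 2" unfolding x_def using assms(3) by auto
    have s: "x / 2 \<le> sin x" using x by (rule half_le_sin)
    have sh: "sinh (t / 4) \<le> t / 2" using sinh_le_double[of "t / 4"] assms by simp
    have "(u / 2)\<^sup>2 = (x / 2 / (t / 2))\<^sup>2" unfolding x_def using assms(1)
      by (simp add: power_divide power_mult_distrib)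
    also have "\<dots> \<le> (sin x / sinh (t / 4))\<^sup>2"
      using x s sh assms(1) by (intro power_mono frac_le) auto
    also have "\<dots> = (sin (t * u / 2))\<^sup>2 / (sinh (t / 4))\<^sup>2"
      unfolding x_def by (simp add: power_divide abs_if)
    finally show ?thesis by (simp add: power_divide)
  qed
  ultimately show ?thesis by linarith
qed

lemma theta_ratio_tendsto:
  "((\<lambda>t. theta_ratio t (t * u)) \<longlongrightarrow> cosh (pi * u)) (at_right 0)"
  unfolding theta_ratio_def prodinf_cosh[symmetric]
proof (rule tendsto_prodinf_dominated[OF _ _ summable_inverse_half_squares[of "u\<^sup>2"]])
  fix j :: nat
  have "((\<lambda>t. (sin (t * u / 2))\<^sup>2 / (sinh (t * c / 2))\<^sup>2) \<longlongrightarrow> u\<^sup>2 / c\<^sup>2) (at_right 0)"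
    if c: "c > 0" for c :: real
  proof -
    \<comment> \<open>The asymptotic computation is done for a known sign of the parameter; oddness
      of the sine and the trivial case 0 cover the rest.\<close>
    have *: "((\<lambda>t. (sin (t * v / 2)) / (sinh (t * c / 2))) \<longlongrightarrow> v / c) (at_right 0)" if "v > 0" for v :: real
      using c that by (real_asymp simp: field_simps)
    have "((\<lambda>t. (sin (t * u / 2)) / (sinh (t * c / 2))) \<longlongrightarrow> u / c) (at_right 0)"
      using *[of u] tendsto_minus[OF *[of "-u"]] by (cases u "0::real" rule: linorder_cases) auto
    from tendsto_power[OF this, of 2] show ?thesis by (simp add: power_divide)
  qed
  thus "((\<lambda>t. (sin (t * u / 2))\<^sup>2 / (sinh (t * (real j + 1/2) / 2))\<^sup>2) \<longlongrightarrow> u\<^sup>2 / (real j + 1/2)\<^sup>2) (at_right 0)"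
    by simp
next
  show "\<forall>\<^sub>F t in at_right 0. \<forall>k. - 1 / 2 \<le> (sin (t * u / 2))\<^sup>2 / (sinh (t * (real k + 1/2) / 2))\<^sup>2 \<and>
      \<bar>(sin (t * u / 2))\<^sup>2 / (sinh (t * (real k + 1/2) / 2))\<^sup>2\<bar> \<le> u\<^sup>2 / (real k + 1/2)\<^sup>2"
    using eventually_at_right_less[of "0::real"]
  proof eventually_elim
    case (elim t)
    have "0 \<le> (sin (t * u / 2))\<^sup>2 / (sinh (t * (real k + 1/2) / 2))\<^sup>2" for k by simp
    moreover from this have "- 1 / 2 \<le> (sin (t * u / 2))\<^sup>2 / (sinh (t * (real k + 1/2) / 2))\<^sup>2" for k
      by (rule order_trans[rotated]) simp
    ultimately show ?case using theta_ratio_summand_le[OF elim] by simp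
  qed
qed auto

lemma integrable_inverse_1_plus_quarter_square: "integrable lborel (\<lambda>u::real. 1 / (1 + u\<^sup>2 / 4))"
proof (rule integrable_FTC_real_line[where G = "\<lambda>u. 2 * arctan (u / 2)"])
  have pos: "1 + u\<^sup>2 / 4 > 0" for u :: real by (intro add_pos_nonneg) auto
  show "((\<lambda>u. 2 * arctan (u / 2)) has_real_derivative 1 / (1 + u\<^sup>2 / 4)) (at u)" for u
    using pos[of u]
    by (auto intro!: derivative_eq_intros simp: power_divide inverse_eq_divide divide_simps)
  show "isCont (\<lambda>u. 1 / (1 + u\<^sup>2 / 4)) u" for u :: real
    using pos[of u] by (auto intro!: continuous_intros)
  show "0 \<le> 1 / (1 + u\<^sup>2 / 4)" for u :: real using pos[of u] by auto
  show "((\<lambda>u. 2 * arctan (u / 2)) \<longlongrightarrow> - pi) at_bot" "((\<lambda>u. 2 * arctan (u / 2)) \<longlongrightarrow> pi) at_top"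
    by real_asymp+
qed

text \<open>Dominated convergence: the indicator confines u to the range of
  \<open>theta_ratio_ge\<close> and is eventually 1 at each fixed u. The character tends to 1, so
  the limit does not depend on \<open>s\<close>.\<close>

lemma integral_theta_ratio_tendsto:
  assumes "l \<ge> 1"
  shows "((\<lambda>t. \<integral>u. indicator {-pi..pi} (t * u) *\<^sub>R
            (of_real (1 / theta_ratio t (t * u) ^ l) * cis (- (real s * (t * u)))) \<partial>lborel)
          \<longlongrightarrow> complex_of_real (2 ^ l * C_const l)) (at_right 0)"
proof -
  define h where "h t u = indicator {-pi..pi} (t * u) *\<^sub>R
            (complex_of_real (1 / theta_ratio t (t * u) ^ l) * cis (- (real s * (t * u))))" for t u
  \<comment> \<open>The convergence theorem is applied along sequences; restricting to
    \<open>{0..1}\<close> keeps them where the lower bound on \<open>theta_ratio\<close>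
    holds.\<close>
  have "((\<lambda>t. integral\<^sup>L lborel (h t)) \<longlongrightarrow> (\<integral>u. complex_of_real (1 / cosh (pi * u) ^ l) \<partial>lborel)) (at 0 within {0..1})"
    unfolding tendsto_at_iff_sequentially o_def
  proof (intro allI impI)
    fix X :: "nat \<Rightarrow> real" assume X: "\<forall>i. X i \<in> {0..1} - {0}" "X \<longlonglongrightarrow> 0"
    have X01: "0 < X i" "X i \<le> 1" for i using X(1)[rule_format, of i] by auto
    have flt: "filterlim X (at_right 0) sequentially"
      using X(2) X01 by (auto simp: filterlim_at less_imp_neq[symmetric])
    show "(\<lambda>i. integral\<^sup>L lborel (h (X i))) \<longlonglongrightarrow> (\<integral>u. complex_of_real (1 / cosh (pi * u) ^ l) \<partial>lborel)"
    proof (rule integral_dominated_convergence)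
      show "integrable lborel (\<lambda>u::real. 1 / (1 + u\<^sup>2 / 4))" by (rule integrable_inverse_1_plus_quarter_square)
      show "(\<lambda>u. complex_of_real (1 / cosh (pi * u) ^ l)) \<in> borel_measurable lborel"
        unfolding measurable_lborel2 by (intro borel_measurable_continuous_onI continuous_intros) auto
      fix i
      note [measurable] = theta_ratio_measurable[OF X01(1)[of i]]
      have [measurable]: "(\<lambda>u. cis (- (real s * (X i * u)))) \<in> borel_measurable borel"
        by (intro borel_measurable_continuous_onI continuous_intros)
      show "h (X i) \<in> borel_measurable lborel"
        unfolding h_def by measurable
      show "AE u in lborel. norm (h (X i) u) \<le> 1 / (1 + u\<^sup>2 / 4)"
      proof (intro always_eventually allI)
        fix u :: real
        have pos: "1 + u\<^sup>2 / 4 > 0" by (intro add_pos_nonneg) auto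
        show "norm (h (X i) u) \<le> 1 / (1 + u\<^sup>2 / 4)"
        proof (cases "\<bar>X i * u\<bar> \<le> pi")
          case True
          have ge: "1 + u\<^sup>2 / 4 \<le> theta_ratio (X i) (X i * u)"
            using X01 True by (intro theta_ratio_ge) auto
          hence "(1 + u\<^sup>2 / 4) ^ 1 \<le> theta_ratio (X i) (X i * u) ^ 1" by simp
          also have "\<dots> \<le> theta_ratio (X i) (X i * u) ^ l"
          proof (rule power_increasing[OF assms])
            have "1 \<le> 1 + u\<^sup>2 / 4" by simp
            thus "1 \<le> theta_ratio (X i) (X i * u)" using ge by linarith
          qed
          finally have "1 + u\<^sup>2 / 4 \<le> theta_ratio (X i) (X i * u) ^ l" by simp
          moreover have "X i * u \<in> {-pi..pi}" using True by auto
          ultimately show ?thesis unfolding h_def using pos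
            by (simp add: norm_mult norm_divide norm_power frac_le flip: power_abs)
        next
          case False
          thus ?thesis unfolding h_def using pos by (auto simp: indicator_def)
        qed
      qed
    next
      show "AE u in lborel. (\<lambda>i. h (X i) u) \<longlonglongrightarrow> complex_of_real (1 / cosh (pi * u) ^ l)"
      proof (intro always_eventually allI)
        fix u :: real
        have "(\<lambda>i. X i * u) \<longlonglongrightarrow> 0" using tendsto_mult_right[OF X(2), of u] by simp
        hence "eventually (\<lambda>i. X i * u \<in> {-pi<..<pi}) sequentially"
          by (rule topological_tendstoD) auto
        hence ev: "eventually (\<lambda>i. (complex_of_real (1 / theta_ratio (X i) (X i * u) ^ l) *
            cis (- (real s * (X i * u)))) = h (X i) u) sequentially"
          by (rule eventually_mono) (auto simp: h_def indicator_def)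
        have "(\<lambda>i. theta_ratio (X i) (X i * u)) \<longlonglongrightarrow> cosh (pi * u)"
          by (rule filterlim_compose[OF theta_ratio_tendsto flt])
        hence "(\<lambda>i. 1 / theta_ratio (X i) (X i * u) ^ l) \<longlonglongrightarrow> 1 / cosh (pi * u) ^ l"
          by (intro tendsto_intros) auto
        moreover have "(\<lambda>i. cis (- (real s * (X i * u)))) \<longlonglongrightarrow> cis (- (real s * (0 * u)))"
        proof -
          have "continuous_on UNIV (\<lambda>x. cis (- (real s * (x * u))))" by (intro continuous_intros)
          hence "isCont (\<lambda>x. cis (- (real s * (x * u)))) 0" by (simp add: continuous_on_eq_continuous_at)
          from isCont_tendsto_compose[OF this X(2)] show ?thesis .
        qed
        ultimately have "(\<lambda>i. complex_of_real (1 / theta_ratio (X i) (X i * u) ^ l) * cis (- (real s * (X i * u))))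
            \<longlonglongrightarrow> complex_of_real (1 / cosh (pi * u) ^ l) * cis (- (real s * (0 * u)))"
          by (intro tendsto_mult tendsto_of_real)
        hence "(\<lambda>i. complex_of_real (1 / theta_ratio (X i) (X i * u) ^ l) * cis (- (real s * (X i * u))))
            \<longlonglongrightarrow> complex_of_real (1 / cosh (pi * u) ^ l)" by simp
        thus "(\<lambda>i. h (X i) u) \<longlonglongrightarrow> complex_of_real (1 / cosh (pi * u) ^ l)"
          using ev by (rule Lim_transform_eventually)
      qed
    qed
  qed
  moreover have "(\<integral>u. complex_of_real (1 / cosh (pi * u) ^ l) \<partial>lborel) = complex_of_real (2 ^ l * C_const l)"
    unfolding integral_complex_of_real integral_sech_power[OF assms] ..
  ultimately show ?thesis unfolding h_def
    by (simp add: at_within_Icc_at_right)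
qed

section \<open>The coefficient as an integral\<close>

lemma convergent_prod_qpoch:
  fixes q z :: complex
  assumes "norm q < 1" "norm z < 1"
  shows "convergent_prod (\<lambda>j. 1 - z * q ^ j)" "\<And>j. 1 - z * q ^ j \<noteq> 0"
proof -
  have lt: "norm (z * q ^ j) < 1" for j
  proof -
    have "norm (z * q ^ j) \<le> norm z * 1"
      unfolding norm_mult norm_power using assms by (intro mult_left_mono power_le_one) auto
    thus ?thesis using assms by simp
  qed
  show nz: "1 - z * q ^ j \<noteq> 0" for j using lt[of j] by auto
  have "convergent_prod (\<lambda>j. 1 + - (z * q ^ j))"
  proof (rule summable_imp_convergent_prod_complex)
    show "summable (\<lambda>j. norm (- (z * q ^ j)))"
      using assms by (simp add: norm_mult norm_power summable_mult summable_geometric)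
    show "- (z * q ^ j) \<noteq> -1" for j using nz[of j] by auto
  qed
  thus "convergent_prod (\<lambda>j. 1 - z * q ^ j)" by simp
qed

lemma qpoch_inf_nonzero:
  assumes "norm q < 1" "norm z < 1" shows "qpoch_inf z q \<noteq> 0"
  unfolding qpoch_inf_def using convergent_prod_qpoch[OF assms] by (rule prodinf_nonzero)

text \<open>The partial products are polynomials in z, and on closed discs inside the unit disc they
  converge uniformly by the M-test with majorant |q|^n.\<close>

lemma holomorphic_qpoch_inf:
  assumes "norm q < 1"
  shows "(\<lambda>z. qpoch_inf z q) holomorphic_on ball 0 1"
proof (rule holomorphic_uniform_sequence)
  show "(\<lambda>z. \<Prod>j<n. 1 - z * q ^ j) holomorphic_on ball 0 1" for n
    by (intro holomorphic_intros)
  fix x :: complex assume "x \<in> ball 0 1"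
  then obtain d where d: "d > 0" "cball x d \<subseteq> ball 0 1"
    by (meson open_ball open_contains_cball)
  have "uniformly_convergent_on (cball x d) (\<lambda>n z. \<Prod>j<n. 1 - z * q ^ j)"
  proof (rule uniformly_convergent_on_prod')
    show "uniformly_convergent_on (cball x d) (\<lambda>N z. \<Sum>n<N. norm (1 - z * q ^ n - 1))"
    proof (rule Weierstrass_m_test')
      show "summable (\<lambda>n. norm q ^ n)" using assms by (simp add: summable_geometric)
      show "norm (norm (1 - z * q ^ n - 1)) \<le> norm q ^ n" if "z \<in> cball x d" for n z
      proof -
        have "norm z \<le> 1" using that d(2) by auto
        hence "norm z * norm q ^ n \<le> 1 * norm q ^ n" by (intro mult_right_mono) auto
        thus ?thesis by (simp add: norm_mult norm_power)
      qed
    qed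
  qed (auto intro!: continuous_intros)
  then obtain g where g: "uniform_limit (cball x d) (\<lambda>n z. \<Prod>j<n. 1 - z * q ^ j) g sequentially"
    unfolding uniformly_convergent_on_def by blast
  have eq: "g z = qpoch_inf z q" if "z \<in> cball x d" for z
  proof (rule LIMSEQ_unique)
    show "(\<lambda>n. \<Prod>j<n. 1 - z * q ^ j) \<longlonglongrightarrow> g z" using g that by (rule tendsto_uniform_limitI)
    have "norm z < 1" using that d(2) by auto
    thus "(\<lambda>n. \<Prod>j<n. 1 - z * q ^ j) \<longlonglongrightarrow> qpoch_inf z q"
      unfolding qpoch_inf_def using assms
      by (intro has_prod_imp_tendsto' convergent_prod_has_prod convergent_prod_qpoch)
  qed
  have "uniform_limit (cball x d) (\<lambda>n z. \<Prod>j<n. 1 - z * q ^ j) g sequentially \<longleftrightarrow>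
      uniform_limit (cball x d) (\<lambda>n z. \<Prod>j<n. 1 - z * q ^ j) (\<lambda>z. qpoch_inf z q) sequentially"
    by (rule uniform_limit_cong') (use eq in auto)
  with g have "uniform_limit (cball x d) (\<lambda>n z. \<Prod>j<n. 1 - z * q ^ j) (\<lambda>z. qpoch_inf z q) sequentially"
    by blast
  thus "\<exists>d>0. cball x d \<subseteq> ball 0 1 \<and>
      uniform_limit (cball x d) (\<lambda>n z. \<Prod>j<n. 1 - z * q ^ j) (\<lambda>z. qpoch_inf z q) sequentially"
    using d by blast
qed auto

lemma qpoch_inf_self:
  assumes "t > 0"
  shows "qpoch_inf (of_real (exp (- t))) (of_real (exp (- t))) = of_real (qprod 1 t)"
proof -
  have "complex_of_real (exp (- t)) * of_real (exp (- t)) ^ j = of_real (exp (- (t * (real j + 1))))" for j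
    by (simp add: exp_of_nat_mult[symmetric] exp_add[symmetric] algebra_simps
             flip: of_real_power of_real_mult)
  hence eq: "1 - complex_of_real (exp (- t)) * of_real (exp (- t)) ^ j =
      of_real (1 - exp (- (t * (real j + 1))))" for j
    by (simp only: of_real_diff of_real_1)
  have "(\<lambda>j. 1 - complex_of_real (exp (- t)) * of_real (exp (- t)) ^ j) has_prod of_real (qprod 1 t)"
    unfolding eq has_prod_of_real_iff using assms by (intro has_prod_qprod) auto
  thus ?thesis unfolding qpoch_inf_def by (simp add: has_prod_iff)
qed

text \<open>The factors pair up as |1 - a cis \<theta>|^2 = (1 - a)^2 + 4 a sin^2 (\<theta>/2) with
  a = q^(j+1/2). Dividing by (1 - a)^2, rewritten by \<open>one_minus_exp_sq\<close>, leaves the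
  factor of \<open>theta_ratio\<close>.\<close>

lemma qpoch_inf_circle:
  assumes "t > 0"
  defines "q \<equiv> complex_of_real (exp (- t))" and "\<rho> \<equiv> complex_of_real (exp (- (t / 2)))"
  shows "qpoch_inf (\<rho> * cis \<theta>) q * qpoch_inf (\<rho> * cis (- \<theta>)) q =
           of_real ((qprod (1/2) t)\<^sup>2 * theta_ratio t \<theta>)"
proof -
  have n: "norm q < 1" "norm (\<rho> * cis x) < 1" for x
    using assms(1) by (auto simp: q_def \<rho>_def norm_mult)
  have factor: "(1 - \<rho> * cis \<theta> * q ^ j) * (1 - \<rho> * cis (- \<theta>) * q ^ j) =
      of_real ((1 - exp (- (t * (real j + 1/2)))) ^ 2 *
        (1 + (sin (\<theta> / 2))\<^sup>2 / (sinh (t * (real j + 1/2) / 2))\<^sup>2))" for j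
  proof -
    define a where "a = exp (- (t * (real j + 1/2)))"
    have a: "\<rho> * q ^ j = of_real a"
      unfolding \<rho>_def q_def a_def
      by (simp add: exp_of_nat_mult[symmetric] exp_add[symmetric] algebra_simps
             flip: of_real_power of_real_mult)
    have "(1 - \<rho> * cis \<theta> * q ^ j) * (1 - \<rho> * cis (- \<theta>) * q ^ j) =
        (1 - (\<rho> * q ^ j) * cis \<theta>) * (1 - (\<rho> * q ^ j) * cis (- \<theta>))" by (simp add: mult_ac)
    also have "\<dots> = of_real (1 - 2 * a * cos \<theta> + a\<^sup>2)"
      unfolding a
    proof -
      have "(1 - of_real a * cis \<theta>) * (1 - of_real a * cis (- \<theta>)) =
          1 - of_real a * (cis \<theta> + cis (- \<theta>)) + (of_real a)\<^sup>2 * (cis \<theta> * cis (- \<theta>))"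
        by (simp only: power2_eq_square ring_distribs mult_ac) simp
      also have "cis \<theta> * cis (- \<theta>) = 1" by (simp add: cis_mult)
      also have "cis \<theta> + cis (- \<theta>) = of_real (2 * cos \<theta>)" by (simp add: complex_eq_iff)
      finally show "(1 - of_real a * cis \<theta>) * (1 - of_real a * cis (- \<theta>)) = of_real (1 - 2 * a * cos \<theta> + a\<^sup>2)"
        by simp
    qed
    also have "1 - 2 * a * cos \<theta> + a\<^sup>2 = (1 - a)\<^sup>2 + 4 * a * (sin (\<theta> / 2))\<^sup>2"
    proof -
      have c: "cos \<theta> = 1 - 2 * (sin (\<theta> / 2))\<^sup>2" using cos_double_sin[of "\<theta> / 2"] by simp
      show ?thesis unfolding c by (simp add: power2_eq_square algebra_simps)
    qed
    also have "\<dots> = (1 - a)\<^sup>2 * (1 + (sin (\<theta> / 2))\<^sup>2 / (sinh (t * (real j + 1/2) / 2))\<^sup>2)"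
    proof -
      have "sinh (t * (real j + 1/2) / 2) \<noteq> 0" using assms(1) by (simp add: add_nonneg_eq_0_iff)
      thus ?thesis using one_minus_exp_sq[of "t * (real j + 1/2)"] unfolding a_def[symmetric]
        by (simp add: field_simps)
    qed
    finally show ?thesis unfolding a_def .
  qed
  have "(\<lambda>j. (1 - exp (- (t * (real j + 1/2)))) ^ 2 *
        (1 + (sin (\<theta> / 2))\<^sup>2 / (sinh (t * (real j + 1/2) / 2))\<^sup>2)) has_prod ((qprod (1/2) t)\<^sup>2 * theta_ratio t \<theta>)"
    using assms(1) by (intro has_prod_mult has_prod_power has_prod_qprod has_prod_theta_ratio) auto
  hence "(\<lambda>j. (1 - \<rho> * cis \<theta> * q ^ j) * (1 - \<rho> * cis (- \<theta>) * q ^ j)) has_prod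
      of_real ((qprod (1/2) t)\<^sup>2 * theta_ratio t \<theta>)"
    unfolding factor has_prod_of_real_iff .
  thus ?thesis unfolding qpoch_inf_def
    by (subst prodinf_mult) (auto simp: has_prod_iff intro: convergent_prod_qpoch n)
qed

text \<open>The coefficient is an integral over the circle whose radius is the square root of q. The
  substitution \<theta> = t u brings in the factor \<open>t\<close> and the scale on which the
  integrand has a limit.\<close>

lemma F_eq_integral:
  assumes "t > 0"
  shows "F l (int s) (of_real (exp (- t))) =
     of_real (qprod 1 t ^ (l\<^sup>2) / qprod (1/2) t ^ (2 * l) * (t / (2 * pi)) * exp (t / 2 * real s)) *
     (\<integral>u. indicator {-pi..pi} (t * u) *\<^sub>R
            (of_real (1 / theta_ratio t (t * u) ^ l) * cis (- (real s * (t * u)))) \<partial>lborel)"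
proof -
  define q where "q = complex_of_real (exp (- t))"
  define \<rho> where "\<rho> = exp (- (t / 2))"
  define E where "E = qprod 1 t"
  define B where "B = qprod (1/2) t"
  define f where "f z = qpoch_inf q q / (qpoch_inf z q ^ l * qpoch_inf (inverse z * q) q ^ l)" for z
  have q: "norm q = exp (- t)" "norm q < 1" unfolding q_def using assms by auto
  have \<rho>: "norm q < \<rho>" "\<rho> < 1" "\<rho> > 0" unfolding q(1) \<rho>_def using assms by auto
  have E: "E > 0" "qpoch_inf q q = of_real E" 
    unfolding E_def q_def using assms qprod_pos[of t 1] qpoch_inf_self[of t] by auto
  have fz: "f (of_real \<rho> * cis \<theta>) * (of_real \<rho> * cis \<theta>) powi (- int s) =
      of_real (E / B ^ (2 * l) * exp (t / 2 * real s)) *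
        (of_real (1 / theta_ratio t \<theta> ^ l) * cis (- (real s * \<theta>)))" for \<theta>
  proof -
    \<comment> \<open>On this circle the map from \<zeta> to q/\<zeta> is complex
      conjugation.\<close>
    have "inverse (of_real \<rho> * cis \<theta>) * q = of_real (exp (t / 2) * exp (- t)) * cis (- \<theta>)"
      unfolding \<rho>_def q_def by (simp add: exp_minus cis_inverse)
    also have "exp (t / 2) * exp (- t) = \<rho>" unfolding \<rho>_def exp_add[symmetric] by simp
    finally have inv: "inverse (of_real \<rho> * cis \<theta>) * q = of_real \<rho> * cis (- \<theta>)" .
    have "qpoch_inf (of_real \<rho> * cis \<theta>) q ^ l * qpoch_inf (of_real \<rho> * cis (-\<theta>)) q ^ l =
        of_real (B\<^sup>2 * theta_ratio t \<theta>) ^ l"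
      unfolding power_mult_distrib[symmetric] \<rho>_def q_def qpoch_inf_circle[OF assms] B_def ..
    hence "f (of_real \<rho> * cis \<theta>) = of_real (E / (B ^ (2 * l) * theta_ratio t \<theta> ^ l))"
      unfolding f_def inv E(2) by (simp add: power_mult_distrib power_mult)
    moreover have "(of_real \<rho> * cis \<theta>) powi (- int s) = of_real (exp (t / 2 * real s)) * cis (- (real s * \<theta>))"
    proof -
      have "\<rho> powi (- int s) = exp (t / 2 * real s)"
        unfolding \<rho>_def by (simp add: power_int_minus exp_of_nat_mult[symmetric] exp_minus[symmetric] mult_ac)
      moreover have "cis \<theta> powi (- int s) = cis (- (real s * \<theta>))"
        by (simp add: cis_power_int)
      ultimately show ?thesis
        by (simp add: power_int_mult_distrib flip: of_real_power_int)
    qed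
    ultimately show ?thesis by (simp add: mult_ac)
  qed
  have "laurent_coeff (norm q) 1 f (int s) =
      (\<integral>\<theta>. indicator {-pi..pi} \<theta> *\<^sub>R
            (f (of_real \<rho> * cis \<theta>) * (of_real \<rho> * cis \<theta>) powi (- int s)) \<partial>lborel) / (2 * pi)"
  proof (rule laurent_coeff_eq_integral)
    show "(\<lambda>z. qpoch_inf q q / qpoch_inf z q ^ l) holomorphic_on ball 0 1"
      using qpoch_inf_nonzero[OF q(2)] by (intro holomorphic_intros holomorphic_qpoch_inf q) auto
    show "(\<lambda>z. 1 / qpoch_inf z q ^ l) holomorphic_on ball 0 1"
      using qpoch_inf_nonzero[OF q(2)] by (intro holomorphic_intros holomorphic_qpoch_inf q) auto
    show "f z = qpoch_inf q q / qpoch_inf z q ^ l * (1 / qpoch_inf (q / z) q ^ l)" for z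
      unfolding f_def by (simp add: divide_inverse mult_ac)
  qed (use \<rho> in auto)
  also have "(\<integral>\<theta>. indicator {-pi..pi} \<theta> *\<^sub>R
            (f (of_real \<rho> * cis \<theta>) * (of_real \<rho> * cis \<theta>) powi (- int s)) \<partial>lborel) =
      \<bar>t\<bar> *\<^sub>R (\<integral>u. indicator {-pi..pi} (0 + t * u) *\<^sub>R
            (f (of_real \<rho> * cis (0 + t * u)) * (of_real \<rho> * cis (0 + t * u)) powi (- int s)) \<partial>lborel)"
    using assms by (intro lborel_integral_real_affine) auto
  also have "\<dots> = of_real (t * (E / B ^ (2 * l) * exp (t / 2 * real s))) * (\<integral>u. indicator {-pi..pi} (t * u) *\<^sub>R
            (of_real (1 / theta_ratio t (t * u) ^ l) * cis (- (real s * (t * u)))) \<partial>lborel)"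
    unfolding fz mult_scaleR_right[symmetric] integral_mult_right_zero
    using assms by (simp add: scaleR_conv_of_real mult_ac)
  finally have lc: "laurent_coeff (norm q) 1 f (int s) =
      of_real (t * (E / B ^ (2 * l) * exp (t / 2 * real s))) * (\<integral>u. indicator {-pi..pi} (t * u) *\<^sub>R
            (of_real (1 / theta_ratio t (t * u) ^ l) * cis (- (real s * (t * u)))) \<partial>lborel) / (2 * pi)" .
  have "F l (int s) q = qpoch_inf q q powi ((int l)\<^sup>2 - 1) * laurent_coeff (norm q) 1 f (int s)"
    unfolding F_def f_def ..
  \<comment> \<open>The missing power of \<open>E\<close> is supplied by the numerator of
    \<open>f\<close>, so the total exponent becomes \<open>l\<^sup>2\<close>.\<close>
  also have "qpoch_inf q q powi ((int l)\<^sup>2 - 1) = of_real (E ^ (l\<^sup>2) / E)"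
    using E by (simp add: power_int_diff flip: of_nat_power)
  finally show ?thesis unfolding lc q_def[symmetric] E_def[symmetric] B_def[symmetric]
    using E(1) by (simp add: field_simps)
qed

section \<open>Asymptotics of the prefactor and conclusion\<close>

text \<open>By \<open>qprod_1_half\<close> the half-integer product is a quotient of Euler products
  and behaves like sqrt 2 exp(-pi^2 / (6t)); its power \<open>2 * l\<close> accounts for
  \<open>2 ^ l\<close>. In the logarithm all explicit terms cancel, leaving a combination of the
  errors \<open>R t\<close> and \<open>R (t / 2)\<close>.\<close>

lemma prefactor_tendsto:
  "((\<lambda>t. qprod 1 t ^ (l\<^sup>2) / qprod (1/2) t ^ (2 * l) * (t / (2 * pi)) * 2 ^ l /
      ((t / (2 * pi)) powr (1 - (real l)\<^sup>2 / 2) * exp (- (pi\<^sup>2 * ((real l)\<^sup>2 - 2 * real l) / (6 * t)))))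
    \<longlongrightarrow> 1) (at_right 0)"
proof -
  define R where "R t = ln (qprod 1 t) + pi\<^sup>2 / (6 * t) - ln (2 * pi / t) / 2" for t
  have R: "(R \<longlongrightarrow> 0) (at_right 0)" unfolding R_def by (rule qprod_1_asymp)
  have "filterlim (\<lambda>t::real. t / 2) (at_right 0) (at_right 0)" by real_asymp
  from filterlim_compose[OF R this] have R2: "((\<lambda>t. R (t / 2)) \<longlongrightarrow> 0) (at_right 0)" .
  have "((\<lambda>t. exp ((real l)\<^sup>2 * R t - 2 * real l * (R (t / 2) - R t))) \<longlongrightarrow>
      exp ((real l)\<^sup>2 * 0 - 2 * real l * (0 - 0))) (at_right 0)"
    by (intro tendsto_intros R R2)
  hence lim: "((\<lambda>t. exp ((real l)\<^sup>2 * R t - 2 * real l * (R (t / 2) - R t))) \<longlongrightarrow> 1) (at_right 0)"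
    by simp
  have "\<forall>\<^sub>F t in at_right 0. exp ((real l)\<^sup>2 * R t - 2 * real l * (R (t / 2) - R t)) =
     qprod 1 t ^ (l\<^sup>2) / qprod (1/2) t ^ (2 * l) * (t / (2 * pi)) * 2 ^ l /
      ((t / (2 * pi)) powr (1 - (real l)\<^sup>2 / 2) * exp (- (pi\<^sup>2 * ((real l)\<^sup>2 - 2 * real l) / (6 * t))))"
    using eventually_at_right_less[of "0::real"]
  proof eventually_elim
    case (elim t)
    define e b x where "e = ln (qprod 1 t)" and "b = ln (qprod (1/2) t)" and "x = ln (t / (2 * pi))"
    have p: "qprod 1 t = exp e" "qprod (1/2) t = exp b" "t / (2 * pi) = exp x"
      unfolding e_def b_def x_def using qprod_pos elim by auto
    have eqs: "ln (qprod 1 (t / 2)) = e + b" "ln (2 * pi / t) = - x" "ln (2 * pi / (t / 2)) = ln 2 - x"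
    proof -
      show "ln (qprod 1 (t / 2)) = e + b"
        unfolding qprod_1_half[OF elim] p exp_add[symmetric] by simp
      show "ln (2 * pi / t) = - x" "ln (2 * pi / (t / 2)) = ln 2 - x"
        using elim ln_realpow[of 2 2] unfolding x_def by (simp_all add: ln_div ln_mult)
    qed
    have "(real l)\<^sup>2 * R t - 2 * real l * (R (t / 2) - R t) =
      real (l\<^sup>2) * e - real (2 * l) * b + x + real l * ln 2 - (1 - (real l)\<^sup>2 / 2) * x
        + pi\<^sup>2 * ((real l)\<^sup>2 - 2 * real l) / (6 * t)"
      unfolding R_def eqs e_def[symmetric] using elim by (simp add: field_simps power2_eq_square)
    moreover have "(2::real) ^ l = exp (real l * ln 2)" by (simp add: exp_of_nat_mult)
    moreover have "exp x powr (1 - (real l)\<^sup>2 / 2) = exp ((1 - (real l)\<^sup>2 / 2) * x)"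
      by (simp add: powr_def)
    ultimately show ?case
      unfolding p by (simp only: exp_add exp_diff exp_of_nat_mult exp_minus) (simp add: field_simps)
  qed
  with lim show ?thesis by (rule Lim_transform_eventually)
qed

theorem theorem1p1:
  fixes l s :: nat
  assumes "l \<ge> 3"
  shows "(\<lambda>t::real. F l (int s) (complex_of_real (exp (- t)))) \<sim>[at_right 0]
         (\<lambda>t. complex_of_real
            (C_const l * (t / (2 * pi)) powr (1 - (real l)\<^sup>2 / 2) *
             exp (- (pi\<^sup>2 * ((real l)\<^sup>2 - 2 * real l) / (6 * t)))))"
proof (rule asymp_equivI')
  have l: "l \<ge> 1" using assms by simp
  define K where "K t = qprod 1 t ^ (l\<^sup>2) / qprod (1/2) t ^ (2 * l) * (t / (2 * pi))" for t
  define T where "T t = (t / (2 * pi)) powr (1 - (real l)\<^sup>2 / 2) *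
             exp (- (pi\<^sup>2 * ((real l)\<^sup>2 - 2 * real l) / (6 * t)))" for t
  define J where "J t = (\<integral>u. indicator {-pi..pi} (t * u) *\<^sub>R
            (complex_of_real (1 / theta_ratio t (t * u) ^ l) * cis (- (real s * (t * u)))) \<partial>lborel)" for t
  have C: "C_const l > 0"
    unfolding C_const_def by (intro divide_pos_pos mult_pos_pos zero_less_power Gamma_real_pos) auto
  have "((\<lambda>t. K t * 2 ^ l / T t) \<longlongrightarrow> 1) (at_right 0)"
    unfolding K_def T_def by (rule prefactor_tendsto)
  moreover have "((\<lambda>t. exp (t / 2 * real s)) \<longlongrightarrow> exp (0 / 2 * real s)) (at_right 0)"
    by (intro tendsto_intros) auto
  moreover have "(J \<longlongrightarrow> complex_of_real (2 ^ l * C_const l)) (at_right 0)"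
    unfolding J_def by (rule integral_theta_ratio_tendsto[OF l])
  \<comment> \<open>The quotient splits into the prefactor, the factor exp (t s / 2) from the radius
    to the power -s, and the integral divided by its nonzero limit; each tends to 1.\<close>
  ultimately have "((\<lambda>t. complex_of_real (K t * 2 ^ l / T t) * of_real (exp (t / 2 * real s)) *
      (J t / of_real (2 ^ l * C_const l))) \<longlongrightarrow>
      of_real 1 * of_real (exp (0 / 2 * real s)) * (of_real (2 ^ l * C_const l) / of_real (2 ^ l * C_const l))) (at_right 0)"
    using C by (intro tendsto_mult tendsto_divide tendsto_of_real tendsto_const) auto
  also have "of_real 1 * of_real (exp (0 / 2 * real s)) * (of_real (2 ^ l * C_const l) / of_real (2 ^ l * C_const l)) = (1 :: complex)"
    using C by simp
  finally have lim: "((\<lambda>t. complex_of_real (K t * 2 ^ l / T t) * of_real (exp (t / 2 * real s)) *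
      (J t / of_real (2 ^ l * C_const l))) \<longlongrightarrow> 1) (at_right 0)" .
  have "\<forall>\<^sub>F t in at_right 0. complex_of_real (K t * 2 ^ l / T t) * of_real (exp (t / 2 * real s)) *
      (J t / of_real (2 ^ l * C_const l)) =
    F l (int s) (complex_of_real (exp (- t))) / complex_of_real (C_const l * (t / (2 * pi)) powr (1 - (real l)\<^sup>2 / 2) *
             exp (- (pi\<^sup>2 * ((real l)\<^sup>2 - 2 * real l) / (6 * t))))"
    using eventually_at_right_less[of "0::real"]
  proof eventually_elim
    case (elim t)
    have Feq: "F l (int s) (complex_of_real (exp (- t))) = of_real (K t * exp (t / 2 * real s)) * J t"
      unfolding K_def J_def by (rule F_eq_integral[OF elim])
    have Teq: "C_const l * (t / (2 * pi)) powr (1 - (real l)\<^sup>2 / 2) *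
             exp (- (pi\<^sup>2 * ((real l)\<^sup>2 - 2 * real l) / (6 * t))) = C_const l * T t"
      unfolding T_def by simp
    show ?case unfolding Feq Teq by (simp add: mult_ac)
  qed
  with lim show "((\<lambda>t. F l (int s) (complex_of_real (exp (- t))) / complex_of_real (C_const l * (t / (2 * pi)) powr (1 - (real l)\<^sup>2 / 2) *
             exp (- (pi\<^sup>2 * ((real l)\<^sup>2 - 2 * real l) / (6 * t))))) \<longlongrightarrow> 1) (at_right 0)"
    by (rule Lim_transform_eventually)
qed

end
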